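(* (1) Let $\tau>0$, $a>0$. There exist constants $c,C>0$ and $\gamma\in(0,1/2]$ depending only on $(a,\tau)$ such that for all integers $s,d$ with $1\le s<\lfloor\gamma d\rfloor/4$, the estimator $\hat\theta$ (defined in the context, with $\tilde\sigma$ built with this $\gamma$) with $\lambda_j=c\log^{1/a}(ed/j)$, $j=1,\dots,d$, satisfies $$\sup_{P_\xi\in\mathcal G_{a,\tau}}\sup_{\sigma>0}\sup_{\theta\in\Theta_s}\mathbf E_{\theta,P_\xi,\sigma}\|\hat\theta-\theta\|_2^2\le C\sigma^2 s\log^{2/a}(ed/s).$$ (2) Let $\tau>0$, $a>2$. There exist constants $c,C>0$ and $\gamma\in(0,1/2]$ depending only on $(a,\tau)$ such that for all integers $s,d$ with $1\le s<\lfloor\gamma d\rfloor/4$, the estimator $\hat\theta$ with $\lambda_j=c(d/j)^{1/a}$, $j=1,\dots,d$, satisfies $$\sup_{P_\xi\in\mathcal P_{a,\tau}}\sup_{\sigma>0}\sup_{\theta\in\Theta_s}\mathbf E_{\theta,P_\xi,\sigma}\|\hat\theta-\theta\|_2^2\le C\sigma^2 s(d/s)^{2/a}.$$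
   Context: Model: for an integer $d\ge1$ we observe $Y=(Y_1,\dots,Y_d)$ with $Y_i=\theta_i+\sigma\xi_i$, where $\theta\in\mathbb R^d$, $\sigma>0$, and $\xi_1,\dots,\xi_d$ are i.i.d. with distribution $P_\xi$, $\mathbf E\xi_1=0$, $\mathbf E\xi_1^2=1$; $\mathbf P_{\theta,P_\xi,\sigma},\mathbf E_{\theta,P_\xi,\sigma}$ denote the law of $Y$ and its expectation; $\Theta_s=\{\theta\in\mathbb R^d:\|\theta\|_0\le s\}$ where $\|\theta\|_0$ counts nonzero coordinates. For $a,\tau>0$, $\mathcal G_{a,\tau}$ is the set of distributions of $\xi_1$ with $\mathbf E\xi_1=0,\mathbf E\xi_1^2=1$ and $\mathbf P(|\xi_1|>t)\le 2e^{-(t/\tau)^a}$ for all $t\ge2$; for $\tau>0,a\ge2$, $\mathcal P_{a,\tau}$ is the set of such distributions with $\mathbf P(|\xi_1|>t)\le(\tau/t)^a$ for all $t\ge2$. Median-of-means: given $\gamma\in(0,1/2]$, $m=\lfloor\gamma d\rfloor$, partition $\{1,\dots,d\}$ into disjoint blocks $B_1,\dots,B_m$ each of cardinality at least $\lfloor d/m\rfloor$, $\bar\sigma_i^2=|B_i|^{-1}\sum_{j\in B_i}Y_j^2$, $\tilde\sigma^2=\mathrm{med}(\bar\sigma_1^2,\dots,\bar\sigma_m^2)$, $\tilde\sigma=\sqrt{\tilde\sigma^2}$. Sorted-$\ell_1$ estimator: for $\lambda_1\ge\dots\ge\lambda_d>0$, $\|\theta\|_*=\sum_{i=1}^d\lambda_i|\theta|_{(d-i+1)}$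 where $|\theta|_{(1)}\le\dots\le|\theta|_{(d)}$ are the order statistics of $|\theta_1|,\dots,|\theta_d|$, and $\hat\theta\in\arg\min_{\theta\in\mathbb R^d}\big(\sum_{i=1}^d(Y_i-\theta_i)^2+\tilde\sigma\|\theta\|_*\big)$. *)

theory Defs
  imports "HOL-Probability.Probability"
begin

text \<open>Vectors in R^d are functions nat => real; only indices 0..d-1 are used.\<close>

definition sorted_l1 :: "nat \<Rightarrow> (nat \<Rightarrow> real) \<Rightarrow> (nat \<Rightarrow> real) \<Rightarrow> real" where
  "sorted_l1 d lam th =
     (let v = rev (sort (map (\<lambda>j. \<bar>th j\<bar>) [0..<d])) in (\<Sum>i<d. lam (Suc i) * v ! i))"

definition med :: "real list \<Rightarrow> real" where
  "med xs = (let ys = sort xs; n = length xs in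
     if odd n then ys ! (n div 2) else (ys ! (n div 2 - 1) + ys ! (n div 2)) / 2)"

definition valid_blocks :: "nat \<Rightarrow> nat \<Rightarrow> (nat \<Rightarrow> nat set) \<Rightarrow> bool" where
  "valid_blocks d m B \<longleftrightarrow>
     (\<forall>i<m. \<forall>j<m. i \<noteq> j \<longrightarrow> B i \<inter> B j = {}) \<and>
     (\<Union>i<m. B i) = {..<d} \<and>
     (\<forall>i<m. card (B i) \<ge> d div m)"

definition mom_sigma :: "nat \<Rightarrow> (nat \<Rightarrow> nat set) \<Rightarrow> (nat \<Rightarrow> real) \<Rightarrow> real" where
  "mom_sigma m B Y =
     sqrt (med (map (\<lambda>i. (\<Sum>j\<in>B i. (Y j)\<^sup>2) / real (card (B i))) [0..<m]))"

definition slope_obj :: "nat \<Rightarrow> (nat \<Rightarrow> real) \<Rightarrow> real \<Rightarrow> (nat \<Rightarrow> real) \<Rightarrow> (nat \<Rightarrow> real) \<Rightarrow> real" where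
  "slope_obj d lam sig Y th = (\<Sum>i<d. (Y i - th i)\<^sup>2) + sig * sorted_l1 d lam th"

definition slope_argmin :: "nat \<Rightarrow> (nat \<Rightarrow> real) \<Rightarrow> real \<Rightarrow> (nat \<Rightarrow> real) \<Rightarrow> (nat \<Rightarrow> real) set" where
  "slope_argmin d lam sig Y =
     {th. (\<forall>i\<ge>d. th i = 0) \<and>
          (\<forall>th'. (\<forall>i\<ge>d. th' i = 0) \<longrightarrow> slope_obj d lam sig Y th \<le> slope_obj d lam sig Y th')}"

definition noise_ok :: "real measure \<Rightarrow> bool" where
  "noise_ok M \<longleftrightarrow> prob_space M \<and> sets M = sets borel \<and>
     integrable M (\<lambda>x. x) \<and> (\<integral>x. x \<partial>M) = 0 \<and>
     integrable M (\<lambda>x. x\<^sup>2) \<and> (\<integral>x. x\<^sup>2 \<partial>M) = 1"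

definition G_class :: "real \<Rightarrow> real \<Rightarrow> real measure set" where
  "G_class a \<tau> = {M. noise_ok M \<and>
     (\<forall>t\<ge>2. measure M {x. \<bar>x\<bar> > t} \<le> 2 * exp (- ((t / \<tau>) powr a)))}"

definition P_class :: "real \<Rightarrow> real \<Rightarrow> real measure set" where
  "P_class a \<tau> = {M. noise_ok M \<and>
     (\<forall>t\<ge>2. measure M {x. \<bar>x\<bar> > t} \<le> (\<tau> / t) powr a)}"

definition Theta :: "nat \<Rightarrow> nat \<Rightarrow> (nat \<Rightarrow> real) set" where
  "Theta d s = {th. (\<forall>i\<ge>d. th i = 0) \<and> card {i. i < d \<and> th i \<noteq> 0} \<le> s}"

definition risk :: "nat \<Rightarrow> real measure \<Rightarrow> real \<Rightarrow> (nat \<Rightarrow> real) \<Rightarrow>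
                     ((nat \<Rightarrow> real) \<Rightarrow> (nat \<Rightarrow> real)) \<Rightarrow> ennreal" where
  "risk d M \<sigma> th est =
     (\<integral>\<^sup>+ \<xi>. ennreal (\<Sum>i<d. (est (\<lambda>j. th j + \<sigma> * \<xi> j) i - th i)\<^sup>2) \<partial>(PiM {..<d} (\<lambda>_. M)))"

end

theory Submission
  imports Defs
begin

text \<open>
  Write \<open>\<lambda>\<^sub>j = c h\<^sub>j\<close>, \<open>u\<close> for the estimation error and \<open>|v|\<^sub>j\<close> for the \<open>j\<close>-th largest absolute
  coordinate of \<open>v\<close>. Comparing top-\<open>k\<close> sums and summing by parts, the penalties of \<open>\<theta>\<close> and of the
  estimator differ by at most \<open>c (\<Sum>\<^sub>j\<^sub>\<le>\<^sub>s h\<^sub>j |u|\<^sub>j - \<Sum>\<^sub>j\<^sub>>\<^sub>s h\<^sub>j |u|\<^sub>j)\<close>.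

  The noise term is bounded through \<open>|\<xi>|\<^sub>j \<le> K h\<^sub>j + \<surd>W\<^sub>j\<close>, where \<open>W\<^sub>j = (K h\<^sub>j)\<^sup>2 \<epsilon>\<^sup>j \<Prod>\<^sub>i (1 + f(\<xi>\<^sub>i) / \<epsilon>)\<close> with
  \<open>f(x) = (x / K h\<^sub>j)\<^sup>2\<close> if \<open>|x| > K h\<^sub>j\<close> and \<open>0\<close> otherwise: if \<open>|\<xi>|\<^sub>j > K h\<^sub>j\<close>, then \<open>j\<close> factors are at least
  \<open>(|\<xi>|\<^sub>j / K h\<^sub>j)\<^sup>2 / \<epsilon>\<close>. The expectation factorises and \<open>E f \<le> \<epsilon> j / d\<close> for large \<open>K\<close>, so \<open>E W\<^sub>j\<close> decays
  geometrically in \<open>j\<close>.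

  Let \<open>\<sigma>'\<close> be the median-of-means scale. When \<open>\<sigma>' \<ge> \<sigma>/2\<close>, the negative part of the penalty absorbs the
  noise terms with \<open>j > s\<close>. The event \<open>\<sigma>' < \<sigma>/2\<close> forces a quarter of the \<open>m\<close> blocks to be uncontaminated
  with empirical second moment of the noise at most \<open>1/2\<close>; by a union bound its probability is at most
  \<open>(1/2)\<^sup>m\<close>, which beats the trivial error bound of order \<open>d\<close>. Finally \<open>E \<sigma>'\<^sup>2 \<le> 4 \<sigma>\<^sup>2\<close>, because a quarter
  of the blocks are uncontaminated with mean at least the median.
\<close>

section \<open>Rearrangement and the sorted penalty\<close>

text \<open>A permutation instead of a sorted list, so that the k largest entries form an index set
  that can be compared with other index sets. Ranks start at 0, which is why weights appear as
  \<open>lam (Suc j)\<close>.\<close>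

definition sorts :: "nat \<Rightarrow> (nat \<Rightarrow> nat) \<Rightarrow> (nat \<Rightarrow> real) \<Rightarrow> bool" where
  "sorts d p v \<longleftrightarrow> bij_betw p {..<d} {..<d} \<and> (\<forall>i j. i \<le> j \<longrightarrow> j < d \<longrightarrow> \<bar>v (p j)\<bar> \<le> \<bar>v (p i)\<bar>)"

text \<open>Sorting the indices by absolute value, instead of the values, yields the permutation; it
  depends on \<open>v\<close> only and therefore serves every weight sequence.\<close>

lemma obtain_sorts:
  obtains p where "sorts d p v" "\<And>lam. sorted_l1 d lam v = (\<Sum>i<d. lam (Suc i) * \<bar>v (p i)\<bar>)"
proof -
  define f where "f = (\<lambda>j. \<bar>v j\<bar>)"
  define ys where "ys = sort_key f [0..<d]"
  define xs where "xs = rev ys"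
  have srt: "sort (map f [0..<d]) = map f ys"
    by (rule properties_for_sort) (simp_all add: ys_def)
  have len: "length xs = d" and dist: "distinct xs" and set: "set xs = {..<d}"
    by (simp_all add: xs_def ys_def atLeast0LessThan)
  have bij: "bij_betw ((!) xs) {..<d} {..<d}"
    by (rule bij_betw_nth[OF dist]) (simp_all only: len set)
  have rs: "rev (sort (map f [0..<d])) = map f xs"
    by (simp add: srt xs_def rev_map)
  have sorted: "sorted (rev (map f xs))"
    by (simp add: xs_def rev_map ys_def sorted_sort_key)
  have "sorts d ((!) xs) v"
    unfolding sorts_def
  proof (intro conjI allI impI)
    fix i j assume "i \<le> j" "j < d"
    then have "map f xs ! j \<le> map f xs ! i"
      using sorted len by (intro sorted_rev_nth_mono) auto
    then show "\<bar>v (xs ! j)\<bar> \<le> \<bar>v (xs ! i)\<bar>"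
      using \<open>i \<le> j\<close> \<open>j < d\<close> len by (simp add: f_def)
  qed (rule bij)
  moreover have "sorted_l1 d lam v = (\<Sum>i<d. lam (Suc i) * \<bar>v (xs ! i)\<bar>)" for lam
    unfolding sorted_l1_def Let_def using rs len by (simp add: f_def)
  ultimately show ?thesis using that by blast
qed

lemma sorts_image:
  assumes "sorts d p v" "k \<le> d"
  shows "p ` {..<k} \<subseteq> {..<d}" "card (p ` {..<k}) = k"
    "(\<Sum>i\<in>p ` {..<k}. g i) = (\<Sum>j<k. g (p j))"
proof -
  have inj: "inj_on p {..<k}"
    using assms by (meson bij_betw_imp_inj_on inj_on_subset lessThan_subset_iff sorts_def)
  show "p ` {..<k} \<subseteq> {..<d}"
    using assms unfolding sorts_def bij_betw_def by auto
  show "card (p ` {..<k}) = k" using inj by (simp add: card_image)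
  show "(\<Sum>i\<in>p ` {..<k}. g i) = (\<Sum>j<k. g (p j))" using inj by (simp add: sum.reindex)
qed

text \<open>Exchange argument: with \<open>P\<close> the top \<open>card A\<close> positions,
  \<open>A - P\<close> and \<open>P - A\<close> have equally many elements, and the smallest top
  value \<open>t\<close> separates the values on the two sets.\<close>

lemma sum_le_top_sum:
  assumes p: "sorts d p v" and A: "A \<subseteq> {..<d}"
  shows "(\<Sum>i\<in>A. \<bar>v i\<bar>) \<le> (\<Sum>j<card A. \<bar>v (p j)\<bar>)"
proof (cases "card A = 0")
  case True
  then show ?thesis using A finite_subset by fastforce
next
  case False
  define k where "k = card A"
  define P where "P = p ` {..<k}"
  define t where "t = \<bar>v (p (k - 1))\<bar>"
  have fA: "finite A" using A finite_subset by blast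
  have "k \<le> d" using A card_mono[of "{..<d}" A] by (simp add: k_def)
  note P = sorts_image[OF p this, folded P_def]
  have fP: "finite P" by (simp add: P_def)
  have c: "card (A - P) = card (P - A)"
    using card_le_sym_Diff[OF fA fP] card_le_sym_Diff[OF fP fA] P(2) k_def by simp
  have "(\<Sum>i\<in>A - P. \<bar>v i\<bar>) \<le> of_nat (card (A - P)) * t"
  proof (rule sum_bounded_above)
    fix i assume i: "i \<in> A - P"
    then have "i \<in> p ` {..<d}" using A p unfolding sorts_def bij_betw_def by auto
    then obtain j where j: "j < d" "i = p j" by auto
    then have "k \<le> j" using i by (auto simp: P_def)
    then show "\<bar>v i\<bar> \<le> t" using p j unfolding sorts_def t_def by auto
  qed
  also have "\<dots> = of_nat (card (P - A)) * t" using c by simp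
  also have "\<dots> \<le> (\<Sum>i\<in>P - A. \<bar>v i\<bar>)"
  proof (rule sum_bounded_below)
    fix i assume "i \<in> P - A"
    then obtain j where "j < k" "i = p j" by (auto simp: P_def)
    then show "t \<le> \<bar>v i\<bar>" using p \<open>k \<le> d\<close> unfolding sorts_def t_def by auto
  qed
  finally have "(\<Sum>i\<in>A - P. \<bar>v i\<bar>) \<le> (\<Sum>i\<in>P - A. \<bar>v i\<bar>)" .
  moreover have "(\<Sum>i\<in>A. \<bar>v i\<bar>) = (\<Sum>i\<in>A \<inter> P. \<bar>v i\<bar>) + (\<Sum>i\<in>A - P. \<bar>v i\<bar>)"
    using fA by (rule sum.Int_Diff)
  moreover have "(\<Sum>i\<in>P. \<bar>v i\<bar>) = (\<Sum>i\<in>A \<inter> P. \<bar>v i\<bar>) + (\<Sum>i\<in>P - A. \<bar>v i\<bar>)"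
    using sum.Int_Diff[OF fP, of _ A] by (simp add: Int_commute)
  ultimately show ?thesis using P(3)[of "\<lambda>i. \<bar>v i\<bar>"] by (simp add: k_def)
qed

text \<open>Summation by parts: decreasing nonnegative weights turn the sum into a nonnegative
  combination of the partial sums of \<open>z\<close>. The induction carries the sharper bound by
  the last weight times the partial sum, because lowering the weight on a nonnegative partial sum
  only decreases it.\<close>

lemma abel_sum_nonneg:
  fixes x z :: "nat \<Rightarrow> real"
  assumes "\<And>k. k \<le> n \<Longrightarrow> 0 \<le> (\<Sum>j<k. z j)"
    and "\<And>i j. i \<le> j \<Longrightarrow> j < n \<Longrightarrow> x j \<le> x i"
    and "\<And>i. i < n \<Longrightarrow> 0 \<le> x i"
  shows "0 \<le> (\<Sum>j<n. x j * z j)"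
proof -
  have "k < n \<Longrightarrow> x k * (\<Sum>j<Suc k. z j) \<le> (\<Sum>j<Suc k. x j * z j)" for k
  proof (induction k)
    case (Suc k)
    have "x (Suc k) * (\<Sum>j<Suc k. z j) \<le> x k * (\<Sum>j<Suc k. z j)"
      using Suc.prems assms(1)[of "Suc k"] assms(2)[of k "Suc k"] by (intro mult_right_mono) auto
    with Suc show ?case by (simp add: distrib_left)
  qed simp
  note step = this
  show ?thesis
  proof (cases n)
    case (Suc k)
    have "0 \<le> x k * (\<Sum>j<Suc k. z j)"
      using assms(1)[of "Suc k"] assms(3)[of k] Suc by (intro mult_nonneg_nonneg) auto
    with step[of k] Suc show ?thesis by (simp del: sum.lessThan_Suc)
  qed simp
qed

text \<open>The first k values of \<open>\<bar>v\<bar>\<close> in the order \<open>q\<close> sum to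
  at most the k largest ones; summation by parts passes from these partial sums to weighted
  sums.\<close>

lemma rearrangement_le:
  assumes p: "sorts d p v" and q: "sorts d q u"
    and x: "\<And>i j. i \<le> j \<Longrightarrow> j < d \<Longrightarrow> x j \<le> x i" "\<And>i. i < d \<Longrightarrow> 0 \<le> x i"
  shows "(\<Sum>j<d. x j * \<bar>v (q j)\<bar>) \<le> (\<Sum>j<d. x j * \<bar>v (p j)\<bar>)"
proof -
  have "0 \<le> (\<Sum>j<d. x j * (\<bar>v (p j)\<bar> - \<bar>v (q j)\<bar>))"
  proof (rule abel_sum_nonneg[OF _ x])
    fix k assume k: "k \<le> d"
    have "(\<Sum>j<k. \<bar>v (q j)\<bar>) \<le> (\<Sum>j<k. \<bar>v (p j)\<bar>)"
      using sum_le_top_sum[OF p sorts_image(1)[OF q k]]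
      unfolding sorts_image(2,3)[OF q k] .
    then show "0 \<le> (\<Sum>j<k. \<bar>v (p j)\<bar> - \<bar>v (q j)\<bar>)" by (simp add: sum_subtractf)
  qed
  then show ?thesis by (simp add: right_diff_distrib sum_subtractf)
qed

text \<open>Summation by parts removes the weights: it suffices to compare, for every k, the k
  largest entries of \<open>th\<close> with those of \<open>ht\<close> and the signed sum of the
  first k entries of \<open>u\<close>. For k at most s this is the triangle inequality; for larger k
  the sparsity of \<open>th\<close> enters.\<close>

lemma sorted_l1_diff_le:
  fixes th ht :: "nat \<Rightarrow> real"
  assumes lam: "\<And>i j. i \<le> j \<Longrightarrow> j < d \<Longrightarrow> lam (Suc j) \<le> lam (Suc i)" "\<And>i. i < d \<Longrightarrow> 0 \<le> lam (Suc i)"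
    and th: "th \<in> Theta d s" and sd: "s \<le> d"
    and p: "sorts d p (\<lambda>i. ht i - th i)"
  shows "sorted_l1 d lam th - sorted_l1 d lam ht
    \<le> (\<Sum>j<d. lam (Suc j) * ((if j < s then 1 else -1) * \<bar>ht (p j) - th (p j)\<bar>))"
proof -
  define u where "u = (\<lambda>i. ht i - th i)"
  note p = p[folded u_def]
  obtain a where a: "sorts d a th" "sorted_l1 d lam th = (\<Sum>i<d. lam (Suc i) * \<bar>th (a i)\<bar>)"
    using obtain_sorts[of d th] by metis
  obtain b where b: "sorts d b ht" "sorted_l1 d lam ht = (\<Sum>i<d. lam (Suc i) * \<bar>ht (b i)\<bar>)"
    using obtain_sorts[of d ht] by metis
  define S0 where "S0 = {i. i < d \<and> th i \<noteq> 0}"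
  have S0: "S0 \<subseteq> {..<d}" "card S0 \<le> s" using th by (auto simp: S0_def Theta_def)
  \<comment> \<open>The support is enlarged to exactly s indices, so that the cardinalities below
    are equalities.\<close>
  obtain S where S: "S0 \<subseteq> S" "S \<subseteq> {..<d}" "card S = s"
    using exists_subset_between[of S0 s "{..<d}"] S0 sd by auto
  have fS: "finite S" using S finite_subset by blast
  have thS: "th i = 0" if "i \<notin> S" for i
    using that S(1) th by (cases "i < d") (auto simp: S0_def Theta_def)
  define T where "T = (\<lambda>k. \<Sum>j<k. \<bar>u (p j)\<bar>)"
  have "0 \<le> (\<Sum>j<d. lam (Suc j) * ((if j < s then 1 else -1) * \<bar>u (p j)\<bar> - \<bar>th (a j)\<bar> + \<bar>ht (b j)\<bar>))"
  proof (rule abel_sum_nonneg[OF _ lam])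
    fix k assume k: "k \<le> d"
    define A where "A = a ` {..<k}"
    note A = sorts_image[OF a(1) k, folded A_def]
    have fA: "finite A" by (simp add: A_def)
    have tri: "\<bar>th i\<bar> \<le> \<bar>ht i\<bar> + \<bar>u i\<bar>" for i by (simp add: u_def)
    have "(\<Sum>i\<in>A. \<bar>th i\<bar>) \<le> (\<Sum>j<k. \<bar>ht (b j)\<bar>) + (\<Sum>j<k. (if j < s then 1 else -1) * \<bar>u (p j)\<bar>)"
    proof (cases "k \<le> s")
      case True
      have "(\<Sum>i\<in>A. \<bar>th i\<bar>) \<le> (\<Sum>i\<in>A. \<bar>ht i\<bar>) + (\<Sum>i\<in>A. \<bar>u i\<bar>)"
        using sum_mono[of A, OF tri] by (simp add: sum.distrib)
      also have "\<dots> \<le> (\<Sum>j<k. \<bar>ht (b j)\<bar>) + (\<Sum>j<k. \<bar>u (p j)\<bar>)"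
        using sum_le_top_sum[OF b(1) A(1)] sum_le_top_sum[OF p A(1)] A(2) by simp
      also have "(\<Sum>j<k. \<bar>u (p j)\<bar>) = (\<Sum>j<k. (if j < s then 1 else -1) * \<bar>u (p j)\<bar>)"
        using True by (intro sum.cong) auto
      finally show ?thesis .
    next
      case False
      define P where "P = p ` {..<k}"
      note P = sorts_image[OF p k, folded P_def]
      have fP: "finite P" by (simp add: P_def)
      \<comment> \<open>\<open>S\<close> is completed to k indices by a set \<open>A'\<close> of
        large entries of \<open>u\<close> outside \<open>S\<close>. There \<open>th\<close>
        vanishes, so \<open>ht\<close> and \<open>u\<close> agree on \<open>A'\<close>; only s
        indices of \<open>P\<close> lie outside \<open>A'\<close>, and they carry at most
        \<open>T s\<close>. This yields the gain \<open>T k - T s\<close> against the loss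
        \<open>T s\<close> on \<open>S\<close>.\<close>
      have "k - s \<le> card (P - S)"
        using diff_card_le_card_Diff[OF fS, of P] P(2) S(3) by simp
      then obtain A' where A': "A' \<subseteq> P - S" "card A' = k - s" "finite A'"
        by (metis obtain_subset_with_card_n)
      have "S \<inter> A' = {}" using A' by auto
      have cD: "card (S \<union> A') = k"
        using card_Un_disjoint[OF fS A'(3) \<open>S \<inter> A' = {}\<close>] A' S False by simp
      have cR: "card (P - A') = s"
        using card_Diff_subset[OF A'(3), of P] A'(1,2) P(2) False by auto
      have D: "S \<union> A' \<subseteq> {..<d}" "P - A' \<subseteq> {..<d}" using S A' P by auto
      have "(\<Sum>i\<in>A. \<bar>th i\<bar>) = (\<Sum>i\<in>A \<inter> S. \<bar>th i\<bar>)"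
        using fA thS by (intro sum.mono_neutral_right) auto
      also have "\<dots> \<le> (\<Sum>i\<in>S. \<bar>th i\<bar>)" using fS by (intro sum_mono2) auto
      also have "\<dots> \<le> (\<Sum>i\<in>S. \<bar>ht i\<bar>) + (\<Sum>i\<in>S. \<bar>u i\<bar>)"
        using sum_mono[of S, OF tri] by (simp add: sum.distrib)
      also have "(\<Sum>i\<in>S. \<bar>u i\<bar>) \<le> T s"
        using sum_le_top_sum[OF p S(2)] S(3) by (simp add: T_def)
      also have "(\<Sum>i\<in>S. \<bar>ht i\<bar>) = (\<Sum>i\<in>S \<union> A'. \<bar>ht i\<bar>) - (\<Sum>i\<in>A'. \<bar>ht i\<bar>)"
        using sum.union_disjoint[OF fS A'(3) \<open>S \<inter> A' = {}\<close>, of "\<lambda>i. \<bar>ht i\<bar>"] by simp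
      also have "(\<Sum>i\<in>S \<union> A'. \<bar>ht i\<bar>) \<le> (\<Sum>j<k. \<bar>ht (b j)\<bar>)"
        using sum_le_top_sum[OF b(1) D(1)] cD by simp
      also have "(\<Sum>i\<in>A'. \<bar>ht i\<bar>) = (\<Sum>i\<in>A'. \<bar>u i\<bar>)"
        using thS A' by (intro sum.cong) (auto simp: u_def)
      also have "\<dots> = (\<Sum>i\<in>P. \<bar>u i\<bar>) - (\<Sum>i\<in>P - A'. \<bar>u i\<bar>)"
        using sum.subset_diff[OF subset_trans[OF A'(1) Diff_subset] fP, of "\<lambda>i. \<bar>u i\<bar>"] by simp
      also have "(\<Sum>i\<in>P. \<bar>u i\<bar>) = T k" by (simp add: P T_def)
      finally have "(\<Sum>i\<in>A. \<bar>th i\<bar>) \<le> (\<Sum>j<k. \<bar>ht (b j)\<bar>) - (T k - (\<Sum>i\<in>P - A'. \<bar>u i\<bar>)) + T s"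
        by simp
      moreover have "(\<Sum>i\<in>P - A'. \<bar>u i\<bar>) \<le> T s"
        using sum_le_top_sum[OF p D(2)] cR by (simp add: T_def)
      moreover have "(\<Sum>j<k. (if j < s then 1 else -1) * \<bar>u (p j)\<bar>) = 2 * T s - T k"
      proof -
        have un: "{..<k} = {..<s} \<union> {s..<k}" using False by auto
        have "T k = T s + (\<Sum>j\<in>{s..<k}. \<bar>u (p j)\<bar>)"
          unfolding T_def un by (rule sum.union_disjoint) auto
        moreover have "(\<Sum>j<k. (if j < s then 1 else -1) * \<bar>u (p j)\<bar>)
          = T s + (\<Sum>j\<in>{s..<k}. - \<bar>u (p j)\<bar>)"
          unfolding T_def un by (subst sum.union_disjoint) auto
        ultimately show ?thesis by (simp add: sum_negf)
      qed
      ultimately show ?thesis by linarith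
    qed
    then show "0 \<le> (\<Sum>j<k. (if j < s then 1 else -1) * \<bar>u (p j)\<bar> - \<bar>th (a j)\<bar> + \<bar>ht (b j)\<bar>)"
      by (simp add: A sum.distrib sum_subtractf)
  qed
  then show ?thesis
    by (simp add: a(2) b(2) u_def sum.distrib sum_subtractf right_diff_distrib distrib_left)
qed

section \<open>The median\<close>

text \<open>All that is used of the median besides its definition. Counting is invariant under
  sorting; in the sorted list the first \<open>m - m div 2\<close> entries lie below the median and
  the last \<open>m - m div 2\<close> above it, for both parities of m.\<close>

lemma med_count:
  fixes x :: "nat \<Rightarrow> real"
  assumes "m > 0"
  shows "m \<le> 2 * card {i. i < m \<and> x i \<le> med (map x [0..<m])}"
    and "m \<le> 2 * card {i. i < m \<and> med (map x [0..<m]) \<le> x i}"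
proof -
  define xs where "xs = map x [0..<m]"
  define ys where "ys = sort xs"
  have len: "length ys = m" "length xs = m" by (simp_all add: ys_def xs_def)
  have cnt: "card {i. i < m \<and> Q (x i)} = card {i. i < m \<and> Q (ys ! i)}" for Q
  proof -
    have "{i. i < m \<and> Q (x i)} = {i. i < length xs \<and> Q (xs ! i)}" by (auto simp: xs_def)
    then have "card {i. i < m \<and> Q (x i)} = length (filter Q xs)"
      by (simp add: length_filter_conv_card)
    also have "\<dots> = size (filter_mset Q (mset xs))" by (metis mset_filter size_mset)
    also have "\<dots> = size (filter_mset Q (mset ys))" by (simp add: ys_def)
    also have "\<dots> = length (filter Q ys)" by (metis mset_filter size_mset)
    finally show ?thesis using len by (simp add: length_filter_conv_card)
  qed
  have mono: "ys ! i \<le> ys ! j" if "i \<le> j" "j < m" for i j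
    using that len by (intro sorted_nth_mono) (auto simp: ys_def)
  have medv: "med xs = (if odd m then ys ! (m div 2) else (ys ! (m div 2 - 1) + ys ! (m div 2)) / 2)"
    by (simp add: med_def Let_def ys_def[symmetric] len)
  have h: "m div 2 < m" using assms by simp
  have lo: "ys ! i \<le> med xs" if "i < m - m div 2" for i
  proof (cases "odd m")
    case True
    then have "i \<le> m div 2" using that by presburger
    then show ?thesis using mono[of i "m div 2"] h True by (simp add: medv)
  next
    case False
    then have "i \<le> m div 2 - 1" using that by presburger
    then show ?thesis
      using mono[of i "m div 2 - 1"] mono[of "m div 2 - 1" "m div 2"] h
        less_imp_diff_less[OF h, of 1] False
      by (simp add: medv field_simps)
  qed
  have hi: "med xs \<le> ys ! i" if "m div 2 \<le> i" "i < m" for i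
    using that mono[of "m div 2" i] mono[of "m div 2 - 1" "m div 2"] h by (auto simp: medv)
  have "card {..<m - m div 2} \<le> card {i. i < m \<and> ys ! i \<le> med xs}"
    using lo by (intro card_mono) auto
  then show "m \<le> 2 * card {i. i < m \<and> x i \<le> med (map x [0..<m])}"
    using cnt[of "\<lambda>y. y \<le> med xs"] by (simp add: xs_def[symmetric])
  have "card {m div 2..<m} \<le> card {i. i < m \<and> med xs \<le> ys ! i}"
    using hi by (intro card_mono) auto
  then show "m \<le> 2 * card {i. i < m \<and> med (map x [0..<m]) \<le> x i}"
    using cnt[of "\<lambda>y. med xs \<le> y"] by (simp add: xs_def[symmetric])
qed

section \<open>Moments of the noise\<close>

text \<open>A truncated square, scaled by the threshold so that for positive \<open>r\<close> every
  nonzero value exceeds 1.\<close>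

definition excess :: "real \<Rightarrow> real \<Rightarrow> real" where
  "excess r x = (if \<bar>x\<bar> > r then (x / r)\<^sup>2 else 0)"

lemma excess_nonneg [simp]: "0 \<le> excess r x"
  by (simp add: excess_def)

lemma excess_measurable [measurable]: "excess r \<in> borel_measurable borel"
  unfolding excess_def by measurable

text \<open>Dyadic layers: where \<open>\<bar>x\<bar>\<close> lies between \<open>2 ^ k * r\<close>
  and \<open>2 ^ Suc k * r\<close> the integrand is at most \<open>4 ^ Suc k\<close>, while the
  layer has probability at most \<open>A * (2 powr - b) ^ k\<close>. The ratio
  \<open>2 powr (2 - b)\<close> of the geometric series is below 1 exactly because
  \<open>b > 2\<close>.\<close>

lemma nn_integral_excess_le:
  assumes M: "prob_space M" "sets M = sets borel"
    and r: "r > 0" and A: "A \<ge> 0" and b: "b > 2"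
    and tail: "\<And>k::nat. measure M {x. \<bar>x\<bar> > 2 ^ k * r} \<le> A * (2 powr - b) ^ k"
  shows "(\<integral>\<^sup>+x. ennreal (excess r x) \<partial>M) \<le> ennreal (4 * A / (1 - 2 powr (2 - b)))"
proof -
  interpret prob_space M by (rule M)
  note [measurable_cong] = M(2)
  define q :: real where "q = 2 powr (2 - b)"
  define E where "E = (\<lambda>k::nat. {x::real. \<bar>x\<bar> > 2 ^ k * r})"
  have E: "E k \<in> sets M" for k unfolding E_def M(2) by measurable
  have q: "0 < q" "q < 1" using b by (auto simp: q_def powr_less_one)
  have pt: "ennreal (excess r x) \<le> (\<Sum>k. ennreal (4 ^ Suc k) * indicator (E k) x)" for x
  proof (cases "\<bar>x\<bar> > r")
    case True
    define y where "y = \<bar>x\<bar> / r"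
    have y1: "y > 1" using True r by (simp add: y_def)
    obtain n :: nat where "y < 2 ^ n" using real_arch_pow[of 2 y] by auto
    then have n: "y \<le> 2 ^ Suc n" unfolding power_Suc using zero_less_power[of "2::real" n] by linarith
    \<comment> \<open>Minimality also gives \<open>2 ^ k < y\<close>, which places \<open>x\<close>
      in the layer \<open>E k\<close>; a single term of the series then suffices.\<close>
    define k where "k = (LEAST n. y \<le> 2 ^ Suc n)"
    have k: "y \<le> 2 ^ Suc k" unfolding k_def using n by (rule LeastI)
    have k': "2 ^ k < y"
    proof (cases k)
      case (Suc l)
      then have "\<not> y \<le> 2 ^ Suc l"
        using not_less_Least[of l "\<lambda>n. y \<le> 2 ^ Suc n"] by (simp add: k_def)
      with Suc show ?thesis by simp
    qed (use y1 in simp)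
    have xE: "x \<in> E k" using k' r by (simp add: E_def y_def field_simps)
    have "excess r x = y\<^sup>2" using True by (simp add: excess_def y_def power_divide)
    also have "\<dots> \<le> (2 ^ Suc k)\<^sup>2" using k y1 by (intro power_mono) auto
    also have "\<dots> = (2\<^sup>2) ^ Suc k" by (metis power_mult mult.commute)
    finally have "ennreal (excess r x) \<le> (\<Sum>k\<in>{k}. ennreal (4 ^ Suc k) * indicator (E k) x)"
      using xE by (simp add: ennreal_leI)
    also have "\<dots> \<le> (\<Sum>k. ennreal (4 ^ Suc k) * indicator (E k) x)"
      by (rule sum_le_suminf) auto
    finally show ?thesis .
  qed (simp add: excess_def)
  have "(\<integral>\<^sup>+x. ennreal (excess r x) \<partial>M) \<le> (\<integral>\<^sup>+x. (\<Sum>k. ennreal (4 ^ Suc k) * indicator (E k) x) \<partial>M)"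
    by (intro nn_integral_mono pt)
  also have "\<dots> = (\<Sum>k. \<integral>\<^sup>+x. ennreal (4 ^ Suc k) * indicator (E k) x \<partial>M)"
    by (intro nn_integral_suminf borel_measurable_times_ennreal borel_measurable_const
        borel_measurable_indicator E)
  also have "\<dots> \<le> (\<Sum>k. ennreal (4 * A * q ^ k))"
  proof (intro suminf_le allI)
    fix k
    have "(\<integral>\<^sup>+x. ennreal (4 ^ Suc k) * indicator (E k) x \<partial>M) = ennreal (4 ^ Suc k * measure M (E k))"
      using E by (simp add: nn_integral_cmult_indicator emeasure_eq_measure ennreal_mult)
    also have "\<dots> \<le> ennreal (4 ^ Suc k * (A * (2 powr - b) ^ k))"
      using tail[of k] by (intro ennreal_leI mult_left_mono) (auto simp: E_def)
    also have "4 ^ Suc k * (A * (2 powr - b) ^ k) = 4 * A * q ^ k"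
      by (simp add: q_def powr_diff powr_minus divide_simps power_mult_distrib power_divide)
    finally show "(\<integral>\<^sup>+x. ennreal (4 ^ Suc k) * indicator (E k) x \<partial>M) \<le> ennreal (4 * A * q ^ k)" .
  qed auto
  also have "\<dots> = ennreal (4 * A * (1 / (1 - q)))"
    using q A by (intro suminf_ennreal_eq sums_mult geometric_sums) auto
  finally show ?thesis by (simp add: q_def)
qed

lemma nn_integral_PiM_prod_le:
  assumes M: "prob_space M" and I: "finite I"
    and g: "\<And>i. i \<in> I \<Longrightarrow> g i \<in> borel_measurable M" "\<And>i x. i \<in> I \<Longrightarrow> 0 \<le> g i x"
    and q: "\<And>i. i \<in> I \<Longrightarrow> (\<integral>\<^sup>+x. ennreal (g i x) \<partial>M) \<le> ennreal (q i)" "\<And>i. i \<in> I \<Longrightarrow> 0 \<le> q i"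
  shows "(\<integral>\<^sup>+\<xi>. ennreal (\<Prod>i\<in>I. g i (\<xi> i)) \<partial>(PiM I (\<lambda>_. M))) \<le> ennreal (\<Prod>i\<in>I. q i)"
proof -
  interpret prob_space M by (rule M)
  interpret P: product_sigma_finite "\<lambda>_. M" by standard
  have "(\<integral>\<^sup>+\<xi>. ennreal (\<Prod>i\<in>I. g i (\<xi> i)) \<partial>(PiM I (\<lambda>_. M)))
      = (\<integral>\<^sup>+\<xi>. (\<Prod>i\<in>I. ennreal (g i (\<xi> i))) \<partial>(PiM I (\<lambda>_. M)))"
    using g by (simp add: prod_ennreal)
  also have "\<dots> = (\<Prod>i\<in>I. \<integral>\<^sup>+x. ennreal (g i x) \<partial>M)"
    using g I by (intro P.product_nn_integral_prod) auto
  also have "\<dots> \<le> (\<Prod>i\<in>I. ennreal (q i))" 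
    using I q(1) by (induction I rule: finite_induct) (auto intro!: mult_mono)
  also have "\<dots> = ennreal (\<Prod>i\<in>I. q i)" using q by (intro prod_ennreal)
  finally show ?thesis .
qed

text \<open>A function of one coordinate is a product whose other factors are constantly 1.\<close>

lemma nn_integral_PiM_component_le:
  assumes M: "prob_space M" and I: "finite I" "k \<in> I"
    and g: "g \<in> borel_measurable M" "\<And>x. 0 \<le> g x"
    and q: "(\<integral>\<^sup>+x. ennreal (g x) \<partial>M) \<le> ennreal q" "0 \<le> q"
  shows "(\<integral>\<^sup>+\<xi>. ennreal (g (\<xi> k)) \<partial>(PiM I (\<lambda>_. M))) \<le> ennreal q"
proof -
  interpret prob_space M by (rule M)
  have "(\<integral>\<^sup>+\<xi>. ennreal (\<Prod>i\<in>I. (if i = k then g (\<xi> i) else 1)) \<partial>(PiM I (\<lambda>_. M)))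
      \<le> ennreal (\<Prod>i\<in>I. if i = k then q else 1)"
    using g q by (intro nn_integral_PiM_prod_le[OF M I(1), of "\<lambda>i x. if i = k then g x else 1"])
      (auto simp: emeasure_space_1)
  then show ?thesis using I by simp
qed

section \<open>The largest noise coordinates\<close>

text \<open>The sum of the majorants \<open>W\<close> over all ranks, with thresholds
  \<open>t (Suc j)\<close>. Being built from finite products over independent coordinates, it is
  measurable and its expectation is explicit, unlike that of the order statistics.\<close>

definition noise_excess :: "nat \<Rightarrow> (nat \<Rightarrow> real) \<Rightarrow> real \<Rightarrow> (nat \<Rightarrow> real) \<Rightarrow> real" where
  "noise_excess d t \<epsilon> \<xi> =
     (\<Sum>j<d. (t (Suc j))\<^sup>2 * (\<epsilon> ^ Suc j * (\<Prod>i<d. 1 + excess (t (Suc j)) (\<xi> i) / \<epsilon>)))"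

lemma order_statistic_le:
  assumes p: "sorts d p \<xi>" and j: "j < d" and t: "t > 0" and \<epsilon>: "0 < \<epsilon>" "\<epsilon> \<le> 1"
  shows "\<bar>\<xi> (p j)\<bar> \<le> t + sqrt (t\<^sup>2 * (\<epsilon> ^ Suc j * (\<Prod>i<d. 1 + excess t (\<xi> i) / \<epsilon>)))"
proof (cases "\<bar>\<xi> (p j)\<bar> > t")
  case False
  have "0 \<le> sqrt (t\<^sup>2 * (\<epsilon> ^ Suc j * (\<Prod>i<d. 1 + excess t (\<xi> i) / \<epsilon>)))"
    using \<epsilon> by (intro real_sqrt_ge_zero mult_nonneg_nonneg prod_nonneg) (auto intro!: add_nonneg_nonneg)
  with False show ?thesis by linarith
next
  case True
  define \<rho> where "\<rho> = (\<bar>\<xi> (p j)\<bar> / t)\<^sup>2"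
  have \<rho>1: "1 \<le> \<rho>" using True t by (simp add: \<rho>_def)
  define P where "P = p ` {..<Suc j}"
  have P: "P \<subseteq> {..<d}" "card P = Suc j"
    unfolding P_def by (rule sorts_image[OF p Suc_leI[OF j]])+
  have ex: "\<rho> \<le> excess t (\<xi> i)" if i: "i \<in> P" for i
  proof -
    obtain l where "l < Suc j" "i = p l" using i unfolding P_def by blast
    then have "\<bar>\<xi> (p j)\<bar> \<le> \<bar>\<xi> i\<bar>" using p j unfolding sorts_def by auto
    moreover from this have "\<rho> \<le> (\<bar>\<xi> i\<bar> / t)\<^sup>2"
      unfolding \<rho>_def using t by (intro power_mono divide_right_mono) auto
    ultimately show ?thesis using True by (simp add: excess_def power_divide)
  qed
  \<comment> \<open>The powers of \<open>\<epsilon>\<close> cancel the prefactor of the majorant; of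
    the powers of \<open>\<rho>\<close> only one is kept, as \<open>\<rho>\<close> is at least 1.
    The factors outside \<open>P\<close> are at least 1 and can be added freely.\<close>
  have "\<rho> / \<epsilon> ^ Suc j \<le> \<rho> ^ Suc j / \<epsilon> ^ Suc j"
    using \<rho>1 \<epsilon> power_increasing[of 1 "Suc j" \<rho>] by (intro divide_right_mono) auto
  also have "\<dots> = (\<Prod>i\<in>P. \<rho> / \<epsilon>)" using P by (simp add: power_divide)
  also have "\<dots> \<le> (\<Prod>i\<in>P. 1 + excess t (\<xi> i) / \<epsilon>)"
  proof (intro prod_mono conjI)
    fix i assume "i \<in> P"
    then have "\<rho> / \<epsilon> \<le> excess t (\<xi> i) / \<epsilon>" using ex \<epsilon> by (intro divide_right_mono) auto
    then show "\<rho> / \<epsilon> \<le> 1 + excess t (\<xi> i) / \<epsilon>" by simp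
  qed (use \<rho>1 \<epsilon> in auto)
  also have "\<dots> \<le> (\<Prod>i<d. 1 + excess t (\<xi> i) / \<epsilon>)"
    using P \<epsilon> by (intro prod_mono2) (auto intro!: divide_nonneg_pos)
  finally have "\<rho> \<le> \<epsilon> ^ Suc j * (\<Prod>i<d. 1 + excess t (\<xi> i) / \<epsilon>)"
    using \<epsilon> by (simp add: pos_divide_le_eq mult.commute del: power_Suc)
  then have "t\<^sup>2 * \<rho> \<le> t\<^sup>2 * (\<epsilon> ^ Suc j * (\<Prod>i<d. 1 + excess t (\<xi> i) / \<epsilon>))"
    by (intro mult_left_mono) auto
  moreover have "t\<^sup>2 * \<rho> = \<bar>\<xi> (p j)\<bar>\<^sup>2" using t by (simp add: \<rho>_def power_divide)
  ultimately have "\<bar>\<xi> (p j)\<bar> \<le> sqrt (t\<^sup>2 * (\<epsilon> ^ Suc j * (\<Prod>i<d. 1 + excess t (\<xi> i) / \<epsilon>)))"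
    by (intro real_le_rsqrt) simp
  then show ?thesis using t by simp
qed

lemma noise_excess_nonneg:
  assumes "0 < \<epsilon>"
  shows "0 \<le> noise_excess d t \<epsilon> \<xi>"
  unfolding noise_excess_def using assms
  by (intro sum_nonneg mult_nonneg_nonneg prod_nonneg) (auto intro!: add_nonneg_nonneg)

text \<open>Rearrangement pairs the largest noise with the largest entry of \<open>u\<close>. The
  thresholds give a weighted sorted sum that the penalty can compensate; the remainders
  \<open>w\<close> are handled by Cauchy-Schwarz.\<close>

lemma noise_sum_le:
  fixes \<xi> u :: "nat \<Rightarrow> real"
  assumes p: "sorts d p u" and t: "\<And>j. j < d \<Longrightarrow> t (Suc j) > 0" and \<epsilon>: "0 < \<epsilon>" "\<epsilon> \<le> 1"
  shows "(\<Sum>i<d. \<xi> i * u i) \<le> (\<Sum>j<d. t (Suc j) * \<bar>u (p j)\<bar>)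
    + sqrt (noise_excess d t \<epsilon> \<xi>) * sqrt (\<Sum>i<d. (u i)\<^sup>2)"
proof -
  obtain r where r: "sorts d r \<xi>" using obtain_sorts[of d \<xi>] by metis
  define w where "w = (\<lambda>j. sqrt ((t (Suc j))\<^sup>2 * (\<epsilon> ^ Suc j * (\<Prod>i<d. 1 + excess (t (Suc j)) (\<xi> i) / \<epsilon>))))"
  have reix: "(\<Sum>i<d. f i) = (\<Sum>j<d. f (p j))" for f :: "nat \<Rightarrow> real"
    using p sum.reindex_bij_betw[of p "{..<d}" "{..<d}" f] by (simp add: sorts_def)
  have w2: "(w j)\<^sup>2 = (t (Suc j))\<^sup>2 * (\<epsilon> ^ Suc j * (\<Prod>i<d. 1 + excess (t (Suc j)) (\<xi> i) / \<epsilon>))" for j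
    unfolding w_def using \<epsilon>
    by (intro real_sqrt_pow2 mult_nonneg_nonneg prod_nonneg) (auto intro!: add_nonneg_nonneg)
  have w0: "\<bar>w j\<bar> = w j" for j
    unfolding w_def using \<epsilon>
    by (intro abs_of_nonneg real_sqrt_ge_zero mult_nonneg_nonneg prod_nonneg) (auto intro!: add_nonneg_nonneg)
  have "(\<Sum>i<d. \<xi> i * u i) = (\<Sum>j<d. \<xi> (p j) * u (p j))" by (rule reix)
  also have "\<dots> \<le> (\<Sum>j<d. \<bar>u (p j)\<bar> * \<bar>\<xi> (p j)\<bar>)"
    by (intro sum_mono) (metis abs_ge_self abs_mult mult.commute)
  also have "\<dots> \<le> (\<Sum>j<d. \<bar>u (p j)\<bar> * \<bar>\<xi> (r j)\<bar>)"
    using p by (intro rearrangement_le[OF r p]) (auto simp: sorts_def)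
  also have "\<dots> \<le> (\<Sum>j<d. \<bar>u (p j)\<bar> * (t (Suc j) + w j))"
    unfolding w_def using order_statistic_le[OF r _ t \<epsilon>] by (intro sum_mono mult_left_mono) auto
  also have "\<dots> = (\<Sum>j<d. t (Suc j) * \<bar>u (p j)\<bar>) + (\<Sum>j<d. w j * \<bar>u (p j)\<bar>)"
    by (simp add: distrib_left sum.distrib mult.commute)
  also have "(\<Sum>j<d. w j * \<bar>u (p j)\<bar>) \<le> sqrt (\<Sum>j<d. (w j)\<^sup>2) * sqrt (\<Sum>j<d. \<bar>u (p j)\<bar>\<^sup>2)"
    using L2_set_mult_ineq[of w "\<lambda>j. u (p j)" "{..<d}"]
    by (simp add: L2_set_def w0)
  also have "(\<Sum>j<d. \<bar>u (p j)\<bar>\<^sup>2) = (\<Sum>i<d. (u i)\<^sup>2)" using reix[of "\<lambda>i. (u i)\<^sup>2"] by simp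
  finally show ?thesis by (simp add: w2 noise_excess_def)
qed

text \<open>By \<open>mom\<close>, each factor has mean at most \<open>1 + Suc j / d\<close>, so the
  product has mean at most \<open>exp (Suc j)\<close>. Together with
  \<open>\<epsilon> ^ Suc j\<close> this is at most \<open>(1/2) ^ Suc j\<close>, and the series
  sums to at most 1; hence only the largest threshold survives in the bound.\<close>

lemma nn_integral_noise_excess_le:
  assumes M: "prob_space M" "sets M = sets borel" and \<epsilon>: "0 < \<epsilon>" "exp 1 * \<epsilon> \<le> 1 / 2" and "d > 0"
    and mom: "\<And>j. j < d \<Longrightarrow> (\<integral>\<^sup>+x. ennreal (excess (t (Suc j)) x) \<partial>M) \<le> ennreal (\<epsilon> * real (Suc j) / real d)"
    and t: "\<And>j. j < d \<Longrightarrow> 0 \<le> t (Suc j) \<and> t (Suc j) \<le> t 1"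
  shows "(\<integral>\<^sup>+\<xi>. ennreal (noise_excess d t \<epsilon> \<xi>) \<partial>(PiM {..<d} (\<lambda>_. M))) \<le> ennreal ((t 1)\<^sup>2)"
proof -
  interpret prob_space M by (rule M)
  note [measurable_cong] = M(2)
  let ?N = "PiM {..<d} (\<lambda>_. M)"
  let ?P = "\<lambda>j \<xi>. \<Prod>i<d. 1 + excess (t (Suc j)) (\<xi> i) / \<epsilon>"
  have P0: "0 \<le> ?P j \<xi>" for j and \<xi> :: "nat \<Rightarrow> real"
    using \<epsilon> by (intro prod_nonneg) (auto intro!: add_nonneg_nonneg)
  have one: "(\<integral>\<^sup>+\<xi>. ennreal (?P j \<xi>) \<partial>?N) \<le> ennreal (exp (real (Suc j)))" if j: "j < d" for j
  proof -
    have "(\<integral>\<^sup>+x. ennreal (1 + excess (t (Suc j)) x / \<epsilon>) \<partial>M)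
      = (\<integral>\<^sup>+x. 1 + ennreal (1 / \<epsilon>) * ennreal (excess (t (Suc j)) x) \<partial>M)"
      using \<epsilon> by (intro nn_integral_cong) (simp add: ennreal_plus ennreal_mult[symmetric])
    also have "\<dots> = 1 + ennreal (1 / \<epsilon>) * (\<integral>\<^sup>+x. ennreal (excess (t (Suc j)) x) \<partial>M)"
      by (subst nn_integral_add) (auto simp: nn_integral_cmult emeasure_space_1)
    also have "\<dots> \<le> 1 + ennreal (1 / \<epsilon>) * ennreal (\<epsilon> * real (Suc j) / real d)"
      using mom[OF j] by (intro add_left_mono mult_left_mono) auto
    also have "\<dots> = ennreal (1 + real (Suc j) / real d)"
      using \<epsilon> by (simp add: ennreal_plus ennreal_mult[symmetric] del: of_nat_Suc)
    finally have "(\<integral>\<^sup>+\<xi>. ennreal (?P j \<xi>) \<partial>?N) \<le> ennreal (\<Prod>i<d. 1 + real (Suc j) / real d)"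
      using \<epsilon> by (intro nn_integral_PiM_prod_le[OF M(1), of _ "\<lambda>i x. 1 + excess (t (Suc j)) x / \<epsilon>"])
        (auto intro!: add_nonneg_nonneg)
    also have "(\<Prod>i<d. 1 + real (Suc j) / real d) \<le> exp (real (Suc j))"
      using exp_ge_one_plus_x_over_n_power_n[of d "real (Suc j)"] \<open>d > 0\<close> by simp
    finally show ?thesis by (simp add: ennreal_leI)
  qed
  have "(\<integral>\<^sup>+\<xi>. ennreal (noise_excess d t \<epsilon> \<xi>) \<partial>?N)
    = (\<integral>\<^sup>+\<xi>. (\<Sum>j<d. ennreal ((t (Suc j))\<^sup>2 * \<epsilon> ^ Suc j) * ennreal (?P j \<xi>)) \<partial>?N)"
    unfolding noise_excess_def using \<epsilon> P0
    by (intro nn_integral_cong) (simp add: sum_ennreal ennreal_mult[symmetric] mult.assoc)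
  also have "\<dots> = (\<Sum>j<d. ennreal ((t (Suc j))\<^sup>2 * \<epsilon> ^ Suc j) * (\<integral>\<^sup>+\<xi>. ennreal (?P j \<xi>) \<partial>?N))"
    by (simp add: nn_integral_sum nn_integral_cmult)
  also have "\<dots> \<le> (\<Sum>j<d. ennreal ((t 1)\<^sup>2 * (1/2) ^ Suc j))"
  proof (intro sum_mono)
    fix j assume "j \<in> {..<d}"
    then have j: "j < d" by simp
    have "ennreal ((t (Suc j))\<^sup>2 * \<epsilon> ^ Suc j) * (\<integral>\<^sup>+\<xi>. ennreal (?P j \<xi>) \<partial>?N)
      \<le> ennreal ((t (Suc j))\<^sup>2 * \<epsilon> ^ Suc j) * ennreal (exp (real (Suc j)))"
      by (intro mult_left_mono one j) auto
    also have "\<dots> = ennreal ((t (Suc j))\<^sup>2 * (exp 1 * \<epsilon>) ^ Suc j)"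
      using \<epsilon> by (simp add: ennreal_mult[symmetric] power_mult_distrib exp_of_nat_mult[symmetric]
          mult.commute mult.left_commute mult.assoc del: power_Suc of_nat_Suc)
    also have "\<dots> \<le> ennreal ((t 1)\<^sup>2 * (1/2) ^ Suc j)"
      using t[OF j] \<epsilon> by (intro ennreal_leI mult_mono power_mono) auto
    finally show "ennreal ((t (Suc j))\<^sup>2 * \<epsilon> ^ Suc j) * (\<integral>\<^sup>+\<xi>. ennreal (?P j \<xi>) \<partial>?N)
      \<le> ennreal ((t 1)\<^sup>2 * (1/2) ^ Suc j)" .
  qed
  also have "\<dots> = ennreal ((t 1)\<^sup>2 * (\<Sum>j<d. (1/2) ^ Suc j))"
    by (simp add: sum_ennreal sum_distrib_left)
  also have "\<dots> \<le> ennreal ((t 1)\<^sup>2 * 1)"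
  proof (intro ennreal_leI mult_left_mono)
    have "(\<Sum>j<d. (1/2::real) ^ Suc j) = 1 - (1/2) ^ d" by (induction d) auto
    then show "(\<Sum>j<d. (1/2::real) ^ Suc j) \<le> 1" by simp
  qed auto
  finally show ?thesis by simp
qed

section \<open>The median of means\<close>

definition clean_blocks :: "nat \<Rightarrow> (nat \<Rightarrow> nat set) \<Rightarrow> (nat \<Rightarrow> real) \<Rightarrow> nat set" where
  "clean_blocks m B \<theta> = {i. i < m \<and> (\<forall>j\<in>B i. \<theta> j = 0)}"

text \<open>Blocks are disjoint, so picking a nonzero coordinate in each contaminated block is
  injective into the support; fewer than a quarter of the blocks are contaminated. Removing them
  from at least half of the blocks leaves at least a quarter.\<close>

lemma card_clean_blocks:
  assumes B: "valid_blocks d m B" and th: "\<theta> \<in> Theta d s" and s: "4 * s < m"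
    and L: "L \<subseteq> {..<m}" "m \<le> 2 * card L"
  shows "m \<le> 4 * card (L \<inter> clean_blocks m B \<theta>)"
proof -
  define D where "D = {i. i < m \<and> (\<exists>j\<in>B i. \<theta> j \<noteq> 0)}"
  have "\<forall>i\<in>D. \<exists>j. j \<in> B i \<and> \<theta> j \<noteq> 0" by (auto simp: D_def)
  then obtain f where f: "\<And>i. i \<in> D \<Longrightarrow> f i \<in> B i \<and> \<theta> (f i) \<noteq> 0" by metis
  have "card D \<le> card {i. i < d \<and> \<theta> i \<noteq> 0}"
  proof (rule card_inj_on_le[of f])
    show "inj_on f D"
    proof (rule inj_onI, rule ccontr)
      fix i j assume "i \<in> D" "j \<in> D" "f i = f j" "i \<noteq> j"
      then have "f i \<in> B i \<inter> B j" "i < m" "j < m" using f[of i] f[of j] by (auto simp: D_def)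
      with B \<open>i \<noteq> j\<close> show False unfolding valid_blocks_def by blast
    qed
    show "f ` D \<subseteq> {i. i < d \<and> \<theta> i \<noteq> 0}"
    proof (rule image_subsetI)
      fix i assume i: "i \<in> D"
      then have "f i \<in> (\<Union>i<m. B i)" using f by (auto simp: D_def)
      then show "f i \<in> {i. i < d \<and> \<theta> i \<noteq> 0}" using B f[OF i] by (auto simp: valid_blocks_def)
    qed
  qed simp
  then have D: "card D \<le> s" using th by (simp add: Theta_def)
  have "L \<subseteq> (L \<inter> clean_blocks m B \<theta>) \<union> D" using L by (auto simp: clean_blocks_def D_def)
  moreover have "finite ((L \<inter> clean_blocks m B \<theta>) \<union> D)"
    by (simp add: clean_blocks_def D_def)
  ultimately have "card L \<le> card ((L \<inter> clean_blocks m B \<theta>) \<union> D)" by (rule card_mono[rotated])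
  also have "\<dots> \<le> card (L \<inter> clean_blocks m B \<theta>) + card D" by (rule card_Un_le)
  finally show ?thesis using D L(2) s by linarith
qed

lemma valid_blocks_card_pos:
  assumes "valid_blocks d m B" "m \<le> d" "i < m"
  shows "0 < card (B i)"
proof -
  have "0 < d div m" using assms by (simp add: div_greater_zero_iff)
  then show ?thesis using assms(1,3) by (force simp: valid_blocks_def)
qed

context
  fixes d m s :: nat and B :: "nat \<Rightarrow> nat set" and \<theta> \<xi> :: "nat \<Rightarrow> real" and \<sigma> :: real
  assumes B: "valid_blocks d m B" and th: "\<theta> \<in> Theta d s" and s: "4 * s < m"
    and md: "m \<le> d" and \<sigma>: "\<sigma> > 0"
begin

lemma clean_block_mean:
  assumes "i \<in> clean_blocks m B \<theta>"
  shows "(\<Sum>j\<in>B i. (\<theta> j + \<sigma> * \<xi> j)\<^sup>2) = \<sigma>\<^sup>2 * (\<Sum>j\<in>B i. (\<xi> j)\<^sup>2)"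
  unfolding sum_distrib_left using assms
  by (intro sum.cong) (auto simp: clean_blocks_def power_mult_distrib)

text \<open>At least one block mean, hence a nonnegative number, lies below the median. Thus the
  square root in \<open>mom_sigma\<close> is a genuine one.\<close>

lemma med_nonneg:
  "0 \<le> med (map (\<lambda>i. (\<Sum>j\<in>B i. (Y j)\<^sup>2) / real (card (B i))) [0..<m])" (is "0 \<le> ?med")
proof -
  have "m \<le> 2 * card {i. i < m \<and> (\<Sum>j\<in>B i. (Y j)\<^sup>2) / real (card (B i)) \<le> ?med}"
    using s by (intro med_count(1)) simp
  then have "0 < card {i. i < m \<and> (\<Sum>j\<in>B i. (Y j)\<^sup>2) / real (card (B i)) \<le> ?med}"
    using s by linarith
  then obtain i where i: "(\<Sum>j\<in>B i. (Y j)\<^sup>2) / real (card (B i)) \<le> ?med"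
    unfolding card_gt_0_iff by blast
  have "0 \<le> (\<Sum>j\<in>B i. (Y j)\<^sup>2) / real (card (B i))" by (intro divide_nonneg_nonneg sum_nonneg) auto
  with i show ?thesis by linarith
qed

text \<open>A Markov-type argument: at least m/4 clean blocks have mean at least the median, so m/4
  times the median is at most the sum of their means. The remaining noise means are added because
  they are nonnegative, which frees the bound from the random choice of blocks.\<close>

lemma mom_sigma_upper:
  "(mom_sigma m B (\<lambda>j. \<theta> j + \<sigma> * \<xi> j))\<^sup>2
    \<le> \<sigma>\<^sup>2 * (4 / real m * (\<Sum>i<m. (\<Sum>j\<in>B i. (\<xi> j)\<^sup>2) / real (card (B i))))"
proof -
  define z where "z = (\<lambda>i. (\<Sum>j\<in>B i. (\<xi> j)\<^sup>2) / real (card (B i)))"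
  define y where "y = (\<lambda>i. (\<Sum>j\<in>B i. (\<theta> j + \<sigma> * \<xi> j)\<^sup>2) / real (card (B i)))"
  define M where "M = med (map y [0..<m])"
  define L where "L = {i. i < m \<and> M \<le> y i}"
  define G where "G = L \<inter> clean_blocks m B \<theta>"
  have m: "m > 0" using s by simp
  have M: "(mom_sigma m B (\<lambda>j. \<theta> j + \<sigma> * \<xi> j))\<^sup>2 = M" "0 \<le> M"
    using med_nonneg[of "\<lambda>j. \<theta> j + \<sigma> * \<xi> j"] by (simp_all add: mom_sigma_def M_def y_def)
  have "m \<le> 2 * card L" unfolding L_def M_def by (rule med_count(2)[OF m])
  then have G: "m \<le> 4 * card G"
    unfolding G_def by (intro card_clean_blocks[OF B th s]) (auto simp: L_def)
  have "real m * M \<le> (4 * real (card G)) * M" using G M(2) by (intro mult_right_mono) auto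
  then have "real m * M \<le> 4 * (real (card G) * M)" by simp
  also have "real (card G) * M \<le> (\<Sum>i\<in>G. y i)" by (rule sum_bounded_below) (auto simp: G_def L_def)
  also have "(\<Sum>i\<in>G. y i) = (\<Sum>i\<in>G. \<sigma>\<^sup>2 * z i)"
    by (intro sum.cong) (auto simp: G_def y_def z_def clean_block_mean)
  also have "\<dots> \<le> (\<Sum>i<m. \<sigma>\<^sup>2 * z i)"
    by (intro sum_mono2 mult_nonneg_nonneg)
      (auto simp: G_def L_def z_def intro!: divide_nonneg_nonneg sum_nonneg)
  finally have "real m * M \<le> 4 * (\<sigma>\<^sup>2 * (\<Sum>i<m. z i))" by (simp add: sum_distrib_left)
  then have "M \<le> 4 * (\<sigma>\<^sup>2 * (\<Sum>i<m. z i)) / real m" using m by (simp add: field_simps)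
  then show ?thesis unfolding M(1) z_def by (simp add: mult.commute mult.left_commute)
qed

lemma mom_sigma_small:
  assumes "mom_sigma m B (\<lambda>j. \<theta> j + \<sigma> * \<xi> j) < \<sigma> / 2"
  obtains I where "I \<subseteq> clean_blocks m B \<theta>" "m \<le> 4 * card I"
    "\<And>i. i \<in> I \<Longrightarrow> (\<Sum>j\<in>B i. (\<xi> j)\<^sup>2) \<le> real (card (B i)) / 2"
proof -
  define y where "y = (\<lambda>i. (\<Sum>j\<in>B i. (\<theta> j + \<sigma> * \<xi> j)\<^sup>2) / real (card (B i)))"
  define M where "M = med (map y [0..<m])"
  define L where "L = {i. i < m \<and> y i \<le> M}"
  define G where "G = L \<inter> clean_blocks m B \<theta>"
  have m: "m > 0" using s by simp
  have M: "mom_sigma m B (\<lambda>j. \<theta> j + \<sigma> * \<xi> j) = sqrt M" "0 \<le> M"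
    using med_nonneg[of "\<lambda>j. \<theta> j + \<sigma> * \<xi> j"] by (simp_all add: mom_sigma_def M_def y_def)
  have "sqrt M < \<sigma> / 2" using assms M by simp
  then have "(sqrt M)\<^sup>2 < (\<sigma> / 2)\<^sup>2" using M(2) by (intro power_strict_mono) auto
  \<comment> \<open>The bound \<open>\<sigma>\<^sup>2 / 4\<close> is relaxed to
    \<open>\<sigma>\<^sup>2 / 2\<close>; half of the expected second moment is already a deviation
    that Chernoff's method detects.\<close>
  then have M4: "M \<le> \<sigma>\<^sup>2 / 2" using M(2) by (simp add: power_divide)
  have "m \<le> 2 * card L" unfolding L_def M_def by (rule med_count(1)[OF m])
  then have G: "m \<le> 4 * card G"
    unfolding G_def by (intro card_clean_blocks[OF B th s]) (auto simp: L_def)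
  show ?thesis
  proof (rule that[OF _ G])
    fix i assume i: "i \<in> G"
    then have "0 < card (B i)" using valid_blocks_card_pos[OF B md] by (auto simp: G_def L_def)
    moreover have "y i \<le> \<sigma>\<^sup>2 / 2" using i M4 by (auto simp: G_def L_def)
    moreover have "y i = \<sigma>\<^sup>2 * (\<Sum>j\<in>B i. (\<xi> j)\<^sup>2) / real (card (B i))"
      using i by (simp add: y_def clean_block_mean G_def)
    ultimately have "\<sigma>\<^sup>2 * (\<Sum>j\<in>B i. (\<xi> j)\<^sup>2) \<le> \<sigma>\<^sup>2 * (real (card (B i)) / 2)"
      by (simp add: divide_simps mult.commute)
    then show "(\<Sum>j\<in>B i. (\<xi> j)\<^sup>2) \<le> real (card (B i)) / 2" using \<sigma> by simp
  qed (simp add: G_def)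
qed

end

section \<open>Chernoff bound for a too small scale\<close>

text \<open>The factor is at least 1 in the product over a block whose empirical second moment is at
  most 1/2, whereas its mean is below 1: this is Chernoff's method with a truncated square.\<close>

definition chernoff_factor :: "real \<Rightarrow> real \<Rightarrow> real" where
  "chernoff_factor r x = exp (1 / (8 * r\<^sup>2) - (if \<bar>x\<bar> \<le> r then x\<^sup>2 / (4 * r\<^sup>2) else 0))"

lemma chernoff_factor_nonneg [simp]: "0 \<le> chernoff_factor r x"
  by (simp add: chernoff_factor_def)

lemma chernoff_factor_measurable [measurable]: "chernoff_factor r \<in> borel_measurable borel"
  unfolding chernoff_factor_def by measurable

text \<open>A bound linear in \<open>y\<close>, so that expectations can be taken. The range up to
  1/4 is that of a square truncated at \<open>r\<^sup>2\<close> and divided by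
  \<open>4 * r\<^sup>2\<close>.\<close>

lemma exp_minus_le_quarter:
  fixes y :: real
  assumes "0 \<le> y" "y \<le> 1 / 4"
  shows "exp (- y) \<le> 1 - 3 / 4 * y"
proof -
  have "1 + y \<le> exp y" by (rule exp_ge_add_one_self)
  then have "exp (- y) \<le> 1 / (1 + y)" using assms by (simp add: exp_minus divide_simps)
  also have "\<dots> \<le> 1 - 3 / 4 * y"
  proof -
    have "y * y \<le> y * (1 / 4)" using assms by (intro mult_left_mono) auto
    then have "1 \<le> (1 - 3 / 4 * y) * (1 + y)" using assms by (simp add: algebra_simps)
    then show ?thesis using assms by (simp add: pos_divide_le_eq)
  qed
  finally show ?thesis .
qed

text \<open>Truncation costs at most 1/4 of the unit second moment, so the truncated square has mean
  at least 3/4. In units of \<open>1 / (64 * r\<^sup>2)\<close> the exponent is then 8 from the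
  constant part minus 9 from the square, that is, -1.\<close>

lemma nn_integral_chernoff_factor_le:
  assumes M: "noise_ok M" and r: "r > 0"
    and ex: "(\<integral>\<^sup>+x. ennreal (excess r x) \<partial>M) \<le> ennreal (1 / (4 * r\<^sup>2))"
  shows "(\<integral>\<^sup>+x. ennreal (chernoff_factor r x) \<partial>M) \<le> ennreal (exp (- 1 / (64 * r\<^sup>2)))"
proof -
  have M': "prob_space M" "sets M = sets borel" "integrable M (\<lambda>x. x\<^sup>2)" "(\<integral>x. x\<^sup>2 \<partial>M) = 1"
    using M by (auto simp: noise_ok_def)
  interpret prob_space M by (rule M')
  note [measurable_cong] = M'(2)
  define \<zeta> where "\<zeta> = (\<lambda>x::real. if \<bar>x\<bar> \<le> r then x\<^sup>2 else 0)"
  have eq: "\<zeta> x = x\<^sup>2 - r\<^sup>2 * excess r x" for x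
    using r by (auto simp: \<zeta>_def excess_def power_divide)
  have int_ex: "integrable M (excess r)"
    using ex by (intro integrableI_nonneg) (auto simp: less_top[symmetric] top_unique)
  have "ennreal (\<integral>x. excess r x \<partial>M) \<le> ennreal (1 / (4 * r\<^sup>2))"
    using ex int_ex by (simp add: nn_integral_eq_integral)
  then have "r\<^sup>2 * (\<integral>x. excess r x \<partial>M) \<le> r\<^sup>2 * (1 / (4 * r\<^sup>2))"
    by (intro mult_left_mono) (auto simp: ennreal_le_iff)
  then have I: "integrable M \<zeta>" "3 / 4 \<le> (\<integral>x. \<zeta> x \<partial>M)"
    using M' int_ex r unfolding eq[abs_def] by auto
  have \<zeta>0: "0 \<le> \<zeta> x" "\<zeta> x \<le> r\<^sup>2" for x
    using r abs_le_square_iff[of x r] by (auto simp: \<zeta>_def)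
  have c: "chernoff_factor r x \<le> exp (1 / (8 * r\<^sup>2)) * (1 - 3 / (16 * r\<^sup>2) * \<zeta> x)" for x
  proof -
    have "chernoff_factor r x = exp (1 / (8 * r\<^sup>2)) * exp (- (\<zeta> x / (4 * r\<^sup>2)))"
      unfolding chernoff_factor_def \<zeta>_def exp_add[symmetric] by simp
    also have "exp (- (\<zeta> x / (4 * r\<^sup>2))) \<le> 1 - 3 / 4 * (\<zeta> x / (4 * r\<^sup>2))"
      using \<zeta>0[of x] r by (intro exp_minus_le_quarter) (auto simp: divide_simps)
    finally show ?thesis by (simp add: mult.commute)
  qed
  have "(\<integral>\<^sup>+x. ennreal (chernoff_factor r x) \<partial>M)
    \<le> (\<integral>\<^sup>+x. ennreal (exp (1 / (8 * r\<^sup>2)) * (1 - 3 / (16 * r\<^sup>2) * \<zeta> x)) \<partial>M)"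
    by (intro nn_integral_mono ennreal_leI c)
  also have "\<dots> = ennreal (\<integral>x. exp (1 / (8 * r\<^sup>2)) * (1 - 3 / (16 * r\<^sup>2) * \<zeta> x) \<partial>M)"
  proof (intro nn_integral_eq_integral AE_I2)
    fix x
    from chernoff_factor_nonneg[of r x] c[of x] show "0 \<le> exp (1 / (8 * r\<^sup>2)) * (1 - 3 / (16 * r\<^sup>2) * \<zeta> x)" by linarith
  qed (use I in auto)
  also have "(\<integral>x. exp (1 / (8 * r\<^sup>2)) * (1 - 3 / (16 * r\<^sup>2) * \<zeta> x) \<partial>M)
    = exp (1 / (8 * r\<^sup>2)) * (1 - 3 / (16 * r\<^sup>2) * (\<integral>x. \<zeta> x \<partial>M))"
    using I(1) by (simp add: prob_space)
  also have "\<dots> \<le> exp (1 / (8 * r\<^sup>2)) * (1 - 3 / (16 * r\<^sup>2) * (3 / 4))"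
    using I(2) r by (intro mult_left_mono diff_left_mono) auto
  also have "\<dots> \<le> exp (1 / (8 * r\<^sup>2)) * exp (- (9 / (64 * r\<^sup>2)))"
    using exp_ge_add_one_self[of "- (9 / (64 * r\<^sup>2))"] by (intro mult_left_mono) auto
  also have "\<dots> = exp (- 1 / (64 * r\<^sup>2))"
    using r by (simp add: exp_add[symmetric] field_simps)
  finally show ?thesis by (simp add: ennreal_leI)
qed

text \<open>The union bound in functional form: one term for every set of at least m/4 blocks from
  \<open>G\<close> that could be simultaneously low. It majorises the indicator of the low-scale
  event.\<close>

definition low_scale_weight :: "nat \<Rightarrow> (nat \<Rightarrow> nat set) \<Rightarrow> nat set \<Rightarrow> real \<Rightarrow> (nat \<Rightarrow> real) \<Rightarrow> real" where
  "low_scale_weight m B G r \<xi> =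
     (\<Sum>I\<in>{I. I \<subseteq> G \<and> m \<le> 4 * card I}. \<Prod>j\<in>(\<Union>i\<in>I. B i). chernoff_factor r (\<xi> j))"

lemma low_scale_weight_nonneg: "0 \<le> low_scale_weight m B G r \<xi>"
  unfolding low_scale_weight_def by (intro sum_nonneg prod_nonneg) simp

lemma low_scale_weight_ge_1:
  assumes B: "valid_blocks d m B" and G: "G \<subseteq> {..<m}" and r: "r > 0"
    and I: "I \<subseteq> G" "m \<le> 4 * card I"
    and low: "\<And>i. i \<in> I \<Longrightarrow> (\<Sum>j\<in>B i. (\<xi> j)\<^sup>2) \<le> real (card (B i)) / 2"
  shows "1 \<le> low_scale_weight m B G r \<xi>"
proof -
  have fI: "finite I" using I G by (meson finite_lessThan finite_subset)
  have fB: "finite (B i)" if "i < m" for i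
    using B that unfolding valid_blocks_def by (metis UN_upper finite_lessThan finite_subset lessThan_iff)
  have one: "1 \<le> (\<Prod>j\<in>B i. chernoff_factor r (\<xi> j))" if i: "i \<in> I" for i
  proof -
    have f: "finite (B i)" using i I G fB by auto
    have "0 \<le> 1 / (4 * r\<^sup>2) * (real (card (B i)) / 2 - (\<Sum>j\<in>B i. (\<xi> j)\<^sup>2))"
      using low[OF i] by simp
    also have "\<dots> = (\<Sum>j\<in>B i. 1 / (8 * r\<^sup>2) - (\<xi> j)\<^sup>2 / (4 * r\<^sup>2))"
      using r by (simp add: sum_subtractf sum_divide_distrib[symmetric] divide_simps sum_distrib_right)
    \<comment> \<open>Truncation only lowers the subtracted square.\<close>
    also have "\<dots> \<le> (\<Sum>j\<in>B i. 1 / (8 * r\<^sup>2) - (if \<bar>\<xi> j\<bar> \<le> r then (\<xi> j)\<^sup>2 / (4 * r\<^sup>2) else 0))"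
      by (intro sum_mono) auto
    finally have "1 \<le> exp \<dots>" by simp
    then show ?thesis using f by (simp add: exp_sum chernoff_factor_def)
  qed
  have "1 \<le> (\<Prod>i\<in>I. \<Prod>j\<in>B i. chernoff_factor r (\<xi> j))" by (intro prod_ge_1 one)
  also have "\<dots> = (\<Prod>j\<in>(\<Union>i\<in>I. B i). chernoff_factor r (\<xi> j))"
  proof (rule prod.UNION_disjoint[symmetric, OF fI])
    show "\<forall>i\<in>I. finite (B i)" using I G fB by auto
    show "\<forall>i\<in>I. \<forall>j\<in>I. i \<noteq> j \<longrightarrow> B i \<inter> B j = {}"
      using B I G unfolding valid_blocks_def by (meson lessThan_iff subsetD)
  qed
  also have "\<dots> \<le> low_scale_weight m B G r \<xi>"
    unfolding low_scale_weight_def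
  proof (rule member_le_sum)
    have "finite (Pow G)" using G finite_subset by blast
    then show "finite {I. I \<subseteq> G \<and> m \<le> 4 * card I}" by (rule rev_finite_subset) auto
  qed (use I in \<open>auto intro!: prod_nonneg\<close>)
  finally show ?thesis .
qed

text \<open>A quarter of the blocks contains at least \<open>512 * r\<^sup>2 * m / 4\<close>
  coordinates, each contributing a factor of mean at most
  \<open>exp (- 1 / (64 * r\<^sup>2))\<close>. This makes each term at most
  \<open>exp (- 2 * m)\<close>, hence at most \<open>(1 / 4) ^ m\<close>, against at most
  \<open>2 ^ m\<close> terms.\<close>

lemma nn_integral_low_scale_weight_le:
  assumes B: "valid_blocks d m B" and G: "G \<subseteq> {..<m}" and r: "r > 0"
    and M: "noise_ok M" and ex: "(\<integral>\<^sup>+x. ennreal (excess r x) \<partial>M) \<le> ennreal (1 / (4 * r\<^sup>2))"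
    and n: "512 * r\<^sup>2 \<le> real (d div m)"
  shows "(\<integral>\<^sup>+\<xi>. ennreal (low_scale_weight m B G r \<xi>) \<partial>(PiM {..<d} (\<lambda>_. M))) \<le> ennreal ((1 / 2) ^ m)"
proof -
  have M': "prob_space M" "sets M = sets borel" using M by (auto simp: noise_ok_def)
  interpret prob_space M by (rule M')
  note [measurable_cong] = M'(2)
  let ?N = "PiM {..<d} (\<lambda>_. M)"
  define \<I> where "\<I> = {I. I \<subseteq> G \<and> m \<le> 4 * card I}"
  define U where "U = (\<lambda>I. \<Union>i\<in>I. B i)"
  define q where "q = exp (- 1 / (64 * r\<^sup>2))"
  have fG: "finite G" using G finite_subset by blast
  have f\<I>: "finite \<I>" using fG by (simp add: \<I>_def)
  have U: "U I \<subseteq> {..<d}" "real (d div m) * real (card I) \<le> real (card (U I))" if I: "I \<in> \<I>" for I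
  proof -
    have IG: "I \<subseteq> {..<m}" using I G by (auto simp: \<I>_def)
    have fI: "finite I" using IG finite_subset by blast
    have "U I \<subseteq> (\<Union>i<m. B i)" using IG by (auto simp: U_def)
    then show U: "U I \<subseteq> {..<d}" using B by (simp add: valid_blocks_def)
    have "card (U I) = (\<Sum>i\<in>I. card (B i))"
      unfolding U_def
    proof (rule card_UN_disjoint[OF fI])
      show "\<forall>i\<in>I. finite (B i)"
        using U unfolding U_def by (meson UN_upper finite_lessThan finite_subset order_trans)
      show "\<forall>i\<in>I. \<forall>j\<in>I. i \<noteq> j \<longrightarrow> B i \<inter> B j = {}"
        using B IG unfolding valid_blocks_def by (meson lessThan_iff subsetD)
    qed
    also have "(\<Sum>i\<in>I. card (B i)) \<ge> card I * (d div m)"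
    proof -
      have "\<And>i. i \<in> I \<Longrightarrow> d div m \<le> card (B i)"
        using B IG unfolding valid_blocks_def by blast
      then show ?thesis using sum_bounded_below[of I "d div m" "\<lambda>i. card (B i)"] by simp
    qed
    finally show "real (d div m) * real (card I) \<le> real (card (U I))"
      by (metis mult.commute of_nat_le_iff of_nat_mult)
  qed
  have one: "(\<integral>\<^sup>+\<xi>. ennreal (\<Prod>j\<in>U I. chernoff_factor r (\<xi> j)) \<partial>?N) \<le> ennreal ((1 / 4) ^ m)"
    if I: "I \<in> \<I>" for I
  proof -
    \<comment> \<open>Factors 1 extend the product to all d coordinates, the index set of the
      product measure.\<close>
    let ?g = "\<lambda>j x. if j \<in> U I then chernoff_factor r x else 1"
    have "(\<integral>\<^sup>+\<xi>. ennreal (\<Prod>j<d. ?g j (\<xi> j)) \<partial>?N) \<le> ennreal (\<Prod>j<d. if j \<in> U I then q else 1)"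
      using nn_integral_chernoff_factor_le[OF M r ex]
      by (intro nn_integral_PiM_prod_le[OF M'(1), of _ ?g])
        (auto simp: q_def emeasure_space_1)
    also have "(\<Prod>j<d. if j \<in> U I then q else 1) = q ^ card (U I)"
      using U(1)[OF I] by (simp add: prod.If_cases Int_absorb1)
    also have "\<dots> = exp (- (real (card (U I)) / (64 * r\<^sup>2)))"
      by (simp add: q_def exp_of_nat_mult[symmetric])
    also have "\<dots> \<le> exp (- 2 * real m)"
    proof -
      have "512 * r\<^sup>2 * (real m / 4) \<le> real (d div m) * real (card I)"
        using n I by (intro mult_mono) (auto simp: \<I>_def)
      also have "\<dots> \<le> real (card (U I))" by (rule U[OF I])
      finally show ?thesis using r by (simp add: field_simps)
    qed
    also have "\<dots> = (exp (- 2)) ^ m" by (simp add: exp_of_nat_mult[symmetric] mult.commute)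
    also have "\<dots> \<le> (1 / 4) ^ m"
    proof (intro power_mono)
      have "(2::real) \<le> exp 1" using exp_ge_add_one_self[of 1] by simp
      then have "(2::real) * 2 \<le> exp 1 * exp 1" by (intro mult_mono) auto
      then have "4 \<le> exp (2::real)" by (simp add: exp_add[symmetric])
      then show "exp (- 2) \<le> (1 / 4 :: real)" by (simp add: exp_minus divide_simps)
    qed auto
    finally have "(\<integral>\<^sup>+\<xi>. ennreal (\<Prod>j<d. ?g j (\<xi> j)) \<partial>?N) \<le> ennreal ((1 / 4) ^ m)"
      by (simp add: ennreal_leI)
    moreover have "(\<Prod>j<d. ?g j (\<xi> j)) = (\<Prod>j\<in>U I. chernoff_factor r (\<xi> j))" for \<xi>
      using U(1)[OF I] by (simp add: prod.If_cases Int_absorb1)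
    ultimately show ?thesis by simp
  qed
  have meas: "(\<lambda>\<xi>. ennreal (\<Prod>j\<in>U I. chernoff_factor r (\<xi> j))) \<in> borel_measurable ?N"
    if I: "I \<in> \<I>" for I
    using U(1)[OF I] by (auto intro!: measurable_compose[OF borel_measurable_prod measurable_ennreal]
        measurable_compose[OF measurable_component_singleton])
  have "(\<integral>\<^sup>+\<xi>. ennreal (low_scale_weight m B G r \<xi>) \<partial>?N)
    = (\<integral>\<^sup>+\<xi>. (\<Sum>I\<in>\<I>. ennreal (\<Prod>j\<in>U I. chernoff_factor r (\<xi> j))) \<partial>?N)"
    by (intro nn_integral_cong) (simp add: low_scale_weight_def \<I>_def U_def sum_ennreal prod_nonneg)
  also have "\<dots> = (\<Sum>I\<in>\<I>. \<integral>\<^sup>+\<xi>. ennreal (\<Prod>j\<in>U I. chernoff_factor r (\<xi> j)) \<partial>?N)"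
    by (intro nn_integral_sum meas)
  also have "\<dots> \<le> (\<Sum>I\<in>\<I>. ennreal ((1 / 4) ^ m))" by (intro sum_mono one)
  also have "\<dots> = ennreal (real (card \<I>) * (1 / 4) ^ m)"
    by (simp add: ennreal_mult ennreal_of_nat_eq_real_of_nat)
  also have "\<dots> \<le> ennreal (2 ^ m * (1 / 4) ^ m)"
  proof (intro ennreal_leI mult_right_mono)
    have "card \<I> \<le> card (Pow {..<m})" using G by (intro card_mono) (auto simp: \<I>_def)
    then have "card \<I> \<le> 2 ^ m" by (simp add: card_Pow)
    then show "real (card \<I>) \<le> 2 ^ m" by (metis of_nat_le_iff of_nat_numeral of_nat_power)
  qed auto
  also have "2 ^ m * (1 / 4 :: real) ^ m = (1 / 2) ^ m" by (simp add: power_mult_distrib[symmetric])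
  finally show ?thesis .
qed

section \<open>The estimation error\<close>

text \<open>Deterministic, for every noise vector and every nonnegative scale \<open>st\<close>.
  Optimality against \<open>\<theta>\<close> bounds \<open>U\<^sup>2\<close> by the noise term plus
  the penalty difference; both are expressed through weighted sorted sums \<open>F\<close> of the
  same error vector, and a bound of the form (x + y + z) U allows division by
  \<open>U\<close>.\<close>

lemma slope_error_le:
  fixes \<theta> \<xi> ht h :: "nat \<Rightarrow> real" and \<sigma> st K \<epsilon> :: real
  assumes ht: "ht \<in> slope_argmin d (\<lambda>j. 4 * K * h j) st (\<lambda>j. \<theta> j + \<sigma> * \<xi> j)"
    and th: "\<theta> \<in> Theta d s" and sd: "s \<le> d" and K: "K > 0" and st: "st \<ge> 0" and \<sigma>: "\<sigma> > 0"
    and h: "\<And>i j. i \<le> j \<Longrightarrow> j < d \<Longrightarrow> h (Suc j) \<le> h (Suc i)" "\<And>i. i < d \<Longrightarrow> 0 < h (Suc i)"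
    and \<epsilon>: "0 < \<epsilon>" "\<epsilon> \<le> 1"
  shows "(\<Sum>i<d. (ht i - \<theta> i)\<^sup>2) \<le> 3 * (4 * \<sigma>\<^sup>2 * K\<^sup>2 * ((\<Sum>j<s. (h (Suc j))\<^sup>2)
      + (if st < \<sigma> / 2 then (\<Sum>j<d. (h (Suc j))\<^sup>2) else 0))
    + 4 * \<sigma>\<^sup>2 * noise_excess d (\<lambda>j. K * h j) \<epsilon> \<xi> + 16 * K\<^sup>2 * st\<^sup>2 * (\<Sum>j<s. (h (Suc j))\<^sup>2))"
proof -
  define u where "u = (\<lambda>i. ht i - \<theta> i)"
  define H where "H = (\<lambda>k. \<Sum>j<k. (h (Suc j))\<^sup>2)"
  define W where "W = noise_excess d (\<lambda>j. K * h j) \<epsilon> \<xi>"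
  define U where "U = sqrt (\<Sum>i<d. (u i)\<^sup>2)"
  let ?pen = "sorted_l1 d (\<lambda>j. 4 * K * h j)"
  obtain p where p: "sorts d p u" using obtain_sorts[of d u] by metis
  define F where "F = (\<lambda>k. \<Sum>j<k. h (Suc j) * \<bar>u (p j)\<bar>)"
  have U2: "U\<^sup>2 = (\<Sum>i<d. (u i)\<^sup>2)" by (simp add: U_def sum_nonneg)
  have U0: "0 \<le> U" by (simp add: U_def sum_nonneg)
  have W0: "0 \<le> W" unfolding W_def by (rule noise_excess_nonneg[OF \<epsilon>(1)])
  have H0: "0 \<le> H k" for k by (simp add: H_def sum_nonneg)

  have "slope_obj d (\<lambda>j. 4 * K * h j) st (\<lambda>j. \<theta> j + \<sigma> * \<xi> j) ht
      \<le> slope_obj d (\<lambda>j. 4 * K * h j) st (\<lambda>j. \<theta> j + \<sigma> * \<xi> j) \<theta>"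
    using ht th by (auto simp: slope_argmin_def Theta_def)
  moreover have "(\<Sum>i<d. (\<theta> i + \<sigma> * \<xi> i - ht i)\<^sup>2)
    = (\<Sum>i<d. (\<sigma> * \<xi> i)\<^sup>2) - 2 * \<sigma> * (\<Sum>i<d. \<xi> i * u i) + (\<Sum>i<d. (u i)\<^sup>2)"
    unfolding sum_distrib_left sum_subtractf[symmetric] sum.distrib[symmetric]
    by (intro sum.cong) (auto simp: u_def power2_eq_square algebra_simps)
  ultimately have basic: "U\<^sup>2 \<le> 2 * \<sigma> * (\<Sum>i<d. \<xi> i * u i) + st * (?pen \<theta> - ?pen ht)"
    unfolding U2 slope_obj_def by (simp add: algebra_simps)

  have split: "(\<Sum>j<d. f j) = (\<Sum>j<s. f j) + (\<Sum>j\<in>{s..<d}. f j)" for f :: "nat \<Rightarrow> real"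
  proof -
    have "{..<d} = {..<s} \<union> {s..<d}" using sd by auto
    then show ?thesis by (simp add: sum.union_disjoint ivl_disj_int)
  qed
  have "(\<Sum>i<d. \<xi> i * u i) \<le> (\<Sum>j<d. K * h (Suc j) * \<bar>u (p j)\<bar>) + sqrt W * U"
    unfolding W_def U_def using K h by (intro noise_sum_le[OF p _ \<epsilon>]) auto
  then have noise: "(\<Sum>i<d. \<xi> i * u i) \<le> K * F d + sqrt W * U"
    by (simp add: F_def sum_distrib_left mult.assoc)
  have "?pen \<theta> - ?pen ht
    \<le> (\<Sum>j<d. 4 * K * h (Suc j) * ((if j < s then 1 else -1) * \<bar>u (p j)\<bar>))"
    unfolding u_def using K h p[unfolded u_def]
    by (intro sorted_l1_diff_le[OF _ _ th sd]) (auto intro!: mult_left_mono less_imp_le)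
  also have "\<dots> = 4 * K * (F s - (F d - F s))"
    unfolding F_def split
    by (simp add: sum_distrib_left sum_negf algebra_simps)
  finally have pen: "?pen \<theta> - ?pen ht \<le> 4 * K * (F s - (F d - F s))" .
  have Fle: "F k \<le> sqrt (H k) * U" if "k \<le> d" for k
  proof -
    have "F k \<le> (\<Sum>j<k. \<bar>h (Suc j)\<bar> * \<bar>u (p j)\<bar>)"
      unfolding F_def by (intro sum_mono mult_right_mono) auto
    also have "\<dots> \<le> L2_set (\<lambda>j. h (Suc j)) {..<k} * L2_set (\<lambda>j. u (p j)) {..<k}"
      by (rule L2_set_mult_ineq)
    also have "\<dots> \<le> sqrt (H k) * U"
    proof -
      have "(\<Sum>j<k. (u (p j))\<^sup>2) \<le> (\<Sum>j<d. (u (p j))\<^sup>2)"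
        using that by (intro sum_mono2) auto
      also have "\<dots> = (\<Sum>i<d. (u i)\<^sup>2)"
        using p sum.reindex_bij_betw[of p "{..<d}" "{..<d}" "\<lambda>i. (u i)\<^sup>2"] by (simp add: sorts_def)
      finally show ?thesis
        unfolding L2_set_def H_def U_def by (intro mult_left_mono) (auto simp: sum_nonneg)
    qed
    finally show ?thesis .
  qed
  have FF: "F s \<le> F d"
    unfolding F_def using sd by (intro sum_mono2) (auto intro!: mult_nonneg_nonneg h(2)[THEN less_imp_le])
  define H' where "H' = (if st < \<sigma> / 2 then H d else H s)"
  define x where "x = 2 * \<sigma> * K * sqrt H'"
  define y where "y = 2 * \<sigma> * sqrt W"
  define z where "z = 4 * K * st * sqrt (H s)"
  have "U\<^sup>2 \<le> 2 * \<sigma> * (K * F d + sqrt W * U) + st * (4 * K * (F s - (F d - F s)))"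
    using basic mult_left_mono[OF noise, of "2 * \<sigma>"] mult_left_mono[OF pen st] \<sigma> by linarith
  also have "\<dots> = 2 * \<sigma> * K * F d + y * U + 4 * K * st * (F s - (F d - F s))"
    by (simp add: y_def algebra_simps)
  \<comment> \<open>If \<open>st\<close> is at least \<open>\<sigma> / 2\<close>, the weight factor
    4 gives \<open>4 * K * st \<ge> 2 * \<sigma> * K\<close>, so the penalty absorbs the noise
    beyond rank s. Otherwise the whole sum \<open>F d\<close> is estimated by Cauchy-Schwarz, at the
    price of \<open>H d\<close> instead of \<open>H s\<close>.\<close>
  also have "\<dots> \<le> x * U + y * U + z * U"
  proof (cases "st < \<sigma> / 2")
    case True
    have "2 * \<sigma> * K * F d \<le> 2 * \<sigma> * K * (sqrt H' * U)"
      using True Fle[of d] \<sigma> K by (intro mult_left_mono) (auto simp: H'_def)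
    moreover have "4 * K * st * (F s - (F d - F s)) \<le> 4 * K * st * (sqrt (H s) * U)"
      using Fle[OF sd] FF st K by (intro mult_left_mono) auto
    ultimately show ?thesis by (simp add: x_def z_def mult.assoc)
  next
    case False
    have "2 * \<sigma> * K * F s \<le> 2 * \<sigma> * K * (sqrt H' * U)"
      using False Fle[OF sd] \<sigma> K by (intro mult_left_mono) (auto simp: H'_def)
    moreover have "4 * K * st * F s \<le> 4 * K * st * (sqrt (H s) * U)"
      using Fle[OF sd] st K by (intro mult_left_mono) auto
    moreover have "0 \<le> (4 * K * st - 2 * \<sigma> * K) * (F d - F s)"
    proof (rule mult_nonneg_nonneg)
      have "0 \<le> 2 * K * (2 * st - \<sigma>)" using False K by (intro mult_nonneg_nonneg) auto
      then show "0 \<le> 4 * K * st - 2 * \<sigma> * K" by (simp add: algebra_simps)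
    qed (use FF in simp)
    ultimately show ?thesis by (simp add: x_def z_def algebra_simps)
  qed
  finally have UU: "U * U \<le> (x + y + z) * U" by (simp add: power2_eq_square algebra_simps)
  have xyz: "0 \<le> x" "0 \<le> y" "0 \<le> z"
    using \<sigma> K st W0 H0 by (auto simp: x_def y_def z_def H'_def)
  have "U \<le> x + y + z"
  proof (cases "U = 0")
    case False
    then show ?thesis using UU U0 by (simp add: mult_le_cancel_right)
  qed (use xyz in simp)
  then have "U\<^sup>2 \<le> (x + y + z)\<^sup>2" using U0 by (intro power_mono) auto
  also have "\<dots> \<le> 3 * (x\<^sup>2 + y\<^sup>2 + z\<^sup>2)"
  proof -
    have "0 \<le> (x - y)\<^sup>2 + (y - z)\<^sup>2 + (x - z)\<^sup>2" by simp
    then show ?thesis by (simp add: power2_eq_square algebra_simps)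
  qed
  finally have le: "U\<^sup>2 \<le> 3 * (x\<^sup>2 + y\<^sup>2 + z\<^sup>2)" .
  have x2: "x\<^sup>2 \<le> 4 * \<sigma>\<^sup>2 * K\<^sup>2 * (H s + (if st < \<sigma> / 2 then H d else 0))"
    using H0 by (auto simp: x_def power_mult_distrib H'_def intro!: mult_left_mono)
  have y2: "y\<^sup>2 = 4 * \<sigma>\<^sup>2 * W" using W0 by (simp add: y_def power_mult_distrib)
  have z2: "z\<^sup>2 = 16 * K\<^sup>2 * st\<^sup>2 * H s" using H0 by (simp add: z_def power_mult_distrib)
  have "U\<^sup>2 \<le> 3 * (4 * \<sigma>\<^sup>2 * K\<^sup>2 * (H s + (if st < \<sigma> / 2 then H d else 0))
      + 4 * \<sigma>\<^sup>2 * W + 16 * K\<^sup>2 * st\<^sup>2 * H s)"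
    by (rule order_trans[OF le[unfolded y2 z2]]) (intro mult_left_mono add_right_mono x2, simp)
  then show ?thesis unfolding U2 unfolding H_def W_def u_def .
qed

section \<open>Measurability of the majorants and the mean of the block averages\<close>

lemma noise_excess_measurable:
  assumes M: "sets M = sets borel"
  shows "noise_excess d t \<epsilon> \<in> borel_measurable (PiM {..<d} (\<lambda>_. M))"
proof -
  note [measurable_cong] = M
  show ?thesis unfolding noise_excess_def[abs_def] by measurable
qed

lemma low_scale_weight_measurable:
  assumes M: "sets M = sets borel" and B: "valid_blocks d m B" and G: "G \<subseteq> {..<m}"
  shows "low_scale_weight m B G r \<in> borel_measurable (PiM {..<d} (\<lambda>_. M))"
  unfolding low_scale_weight_def[abs_def]
proof (intro borel_measurable_sum borel_measurable_prod)
  note [measurable_cong] = M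
  fix I j assume "I \<in> {I. I \<subseteq> G \<and> m \<le> 4 * card I}" "j \<in> (\<Union>i\<in>I. B i)"
  then have "j \<in> (\<Union>i<m. B i)" using G by auto
  then have "j \<in> {..<d}" using B unfolding valid_blocks_def by blast
  then show "(\<lambda>\<xi>. chernoff_factor r (\<xi> j)) \<in> borel_measurable (PiM {..<d} (\<lambda>_. M))"
    by measurable
qed

lemma nn_integral_block_means_le:
  assumes M: "noise_ok M" and B: "valid_blocks d m B" and m: "0 < m" "m \<le> d"
  shows "(\<integral>\<^sup>+\<xi>. ennreal (\<Sum>i<m. (\<Sum>j\<in>B i. (\<xi> j)\<^sup>2) / real (card (B i))) \<partial>(PiM {..<d} (\<lambda>_. M))) \<le> ennreal (real m)"
    and "(\<lambda>\<xi>. \<Sum>i<m. (\<Sum>j\<in>B i. (\<xi> j)\<^sup>2) / real (card (B i))) \<in> borel_measurable (PiM {..<d} (\<lambda>_. M))"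
proof -
  have M': "prob_space M" "sets M = sets borel" "integrable M (\<lambda>x. x\<^sup>2)" "(\<integral>x. x\<^sup>2 \<partial>M) = 1"
    using M by (auto simp: noise_ok_def)
  interpret prob_space M by (rule M')
  note [measurable_cong] = M'(2)
  let ?N = "PiM {..<d} (\<lambda>_. M)"
  have Bd: "j \<in> {..<d}" if "i < m" "j \<in> B i" for i j
  proof -
    have "j \<in> (\<Union>i<m. B i)" using that by auto
    then show ?thesis using B unfolding valid_blocks_def by blast
  qed
  have meas: "(\<lambda>\<xi>. (\<xi> j)\<^sup>2) \<in> borel_measurable ?N" if "i < m" "j \<in> B i" for i j
    using Bd[OF that] by measurable
  show "(\<lambda>\<xi>. \<Sum>i<m. (\<Sum>j\<in>B i. (\<xi> j)\<^sup>2) / real (card (B i))) \<in> borel_measurable ?N"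
    by (intro borel_measurable_sum borel_measurable_divide meas borel_measurable_const) auto
  have sq: "(\<integral>\<^sup>+x. ennreal (x\<^sup>2) \<partial>M) \<le> ennreal 1"
    using M' by (simp add: nn_integral_eq_integral)
  have one: "(\<integral>\<^sup>+\<xi>. ennreal ((\<xi> j)\<^sup>2) \<partial>?N) \<le> 1" if "i < m" "j \<in> B i" for i j
    using nn_integral_PiM_component_le[OF M'(1) _ Bd[OF that] _ _ sq] by simp
  let ?w = "\<lambda>i. ennreal (1 / real (card (B i)))"
  have "(\<integral>\<^sup>+\<xi>. ennreal (\<Sum>i<m. (\<Sum>j\<in>B i. (\<xi> j)\<^sup>2) / real (card (B i))) \<partial>?N)
    = (\<integral>\<^sup>+\<xi>. (\<Sum>i<m. \<Sum>j\<in>B i. ?w i * ennreal ((\<xi> j)\<^sup>2)) \<partial>?N)"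
    by (intro nn_integral_cong)
      (simp add: sum_ennreal ennreal_mult[symmetric] sum_divide_distrib sum_nonneg)
  also have "\<dots> = (\<Sum>i<m. \<Sum>j\<in>B i. ?w i * (\<integral>\<^sup>+\<xi>. ennreal ((\<xi> j)\<^sup>2) \<partial>?N))"
  proof -
    have m': "(\<lambda>\<xi>. ennreal ((\<xi> j)\<^sup>2)) \<in> borel_measurable ?N" if "i < m" "j \<in> B i" for i j
      by (intro measurable_compose[OF meas[OF that] measurable_ennreal])
    have "(\<integral>\<^sup>+\<xi>. (\<Sum>i<m. \<Sum>j\<in>B i. ?w i * ennreal ((\<xi> j)\<^sup>2)) \<partial>?N)
      = (\<Sum>i<m. \<integral>\<^sup>+\<xi>. (\<Sum>j\<in>B i. ?w i * ennreal ((\<xi> j)\<^sup>2)) \<partial>?N)"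
      by (intro nn_integral_sum borel_measurable_sum borel_measurable_times_ennreal
          borel_measurable_const m') auto
    also have "\<dots> = (\<Sum>i<m. \<Sum>j\<in>B i. ?w i * (\<integral>\<^sup>+\<xi>. ennreal ((\<xi> j)\<^sup>2) \<partial>?N))"
    proof (intro sum.cong refl)
      fix i assume "i \<in> {..<m}"
      then have i: "i < m" by simp
      have "(\<integral>\<^sup>+\<xi>. (\<Sum>j\<in>B i. ?w i * ennreal ((\<xi> j)\<^sup>2)) \<partial>?N)
        = (\<Sum>j\<in>B i. \<integral>\<^sup>+\<xi>. ?w i * ennreal ((\<xi> j)\<^sup>2) \<partial>?N)"
        by (intro nn_integral_sum borel_measurable_times_ennreal borel_measurable_const m'[OF i])
      also have "\<dots> = (\<Sum>j\<in>B i. ?w i * (\<integral>\<^sup>+\<xi>. ennreal ((\<xi> j)\<^sup>2) \<partial>?N))"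
        by (intro sum.cong refl nn_integral_cmult m'[OF i])
      finally show "(\<integral>\<^sup>+\<xi>. (\<Sum>j\<in>B i. ?w i * ennreal ((\<xi> j)\<^sup>2)) \<partial>?N) = \<dots>" .
    qed
    finally show ?thesis .
  qed
  also have "\<dots> \<le> (\<Sum>i<m. \<Sum>j\<in>B i. ?w i * 1)"
    by (intro sum_mono mult_left_mono one) auto
  also have "\<dots> = (\<Sum>i<m. 1)"
  proof (intro sum.cong refl)
    fix i assume "i \<in> {..<m}"
    then have "0 < card (B i)" using valid_blocks_card_pos[OF B m(2)] by simp
    then show "(\<Sum>j\<in>B i. ?w i * 1) = 1"
      by (simp add: ennreal_of_nat_eq_real_of_nat ennreal_mult[symmetric])
  qed
  also have "\<dots> = ennreal (real m)" by (simp add: ennreal_of_nat_eq_real_of_nat)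
  finally show "(\<integral>\<^sup>+\<xi>. ennreal (\<Sum>i<m. (\<Sum>j\<in>B i. (\<xi> j)\<^sup>2) / real (card (B i))) \<partial>?N) \<le> ennreal (real m)" .
qed

lemma sum_powr_neg_le:
  fixes \<beta> :: real
  assumes "0 \<le> \<beta>" "\<beta> < 1"
  shows "(\<Sum>j<k. real (Suc j) powr - \<beta>) \<le> real k powr (1 - \<beta>) / (1 - \<beta>)"
proof (induction k)
  case (Suc k)
  show ?case
  proof (cases "k = 0")
    case True
    then show ?thesis using assms by (simp add: divide_simps)
  next
    case False
    define x where "x = real (Suc k)"
    have x: "x > 1" using False by (simp add: x_def)
    \<comment> \<open>Discrete form of integrating the power \<open>- \<beta>\<close>: Young's
      inequality with second factor 1 is the concavity bound
      \<open>(1 - 1 / x) powr (1 - \<beta>) \<le> 1 - (1 - \<beta>) / x\<close>, which makes the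
      increment of the right-hand side large enough.\<close>
    have "(1 - 1 / x) powr (1 - \<beta>) * 1 powr \<beta> \<le> (1 - \<beta>) * (1 - 1 / x) + \<beta> * 1"
      using assms x by (intro Youngs_inequality_0) auto
    then have "x powr (1 - \<beta>) * (1 - 1 / x) powr (1 - \<beta>) \<le> x powr (1 - \<beta>) * (1 - (1 - \<beta>) / x)"
      by (intro mult_left_mono) (auto simp: algebra_simps diff_divide_distrib)
    moreover have "x powr (1 - \<beta>) * (1 - 1 / x) powr (1 - \<beta>) = real k powr (1 - \<beta>)"
      using x by (simp add: powr_mult[symmetric] right_diff_distrib) (simp add: x_def)
    moreover have "x powr (1 - \<beta>) * (1 - (1 - \<beta>) / x) = x powr (1 - \<beta>) - (1 - \<beta>) * x powr - \<beta>"
      using x by (simp add: powr_diff powr_minus field_simps)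
    ultimately have "real k powr (1 - \<beta>) + (1 - \<beta>) * x powr - \<beta> \<le> x powr (1 - \<beta>)" by linarith
    from divide_right_mono[OF this, of "1 - \<beta>"]
    have "real k powr (1 - \<beta>) / (1 - \<beta>) + x powr - \<beta> \<le> x powr (1 - \<beta>) / (1 - \<beta>)"
      using assms by (simp add: add_divide_distrib)
    with Suc show ?thesis by (simp add: x_def)
  qed
qed simp

text \<open>The squared weights grow towards small ranks at most like the power
  \<open>- \<beta>\<close>. With \<open>\<beta> < 1\<close> that power is summable at the origin, so
  the sum is governed by k times its last term.\<close>

lemma sum_squares_weights_le:
  fixes h :: "nat \<Rightarrow> real"
  assumes \<beta>: "0 \<le> \<beta>" "\<beta> < 1" and C: "0 \<le> C"
    and reg: "\<And>j. 1 \<le> j \<Longrightarrow> j \<le> k \<Longrightarrow> (h j)\<^sup>2 \<le> C * (real k / real j) powr \<beta> * (h k)\<^sup>2"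
  shows "(\<Sum>j<k. (h (Suc j))\<^sup>2) \<le> C / (1 - \<beta>) * real k * (h k)\<^sup>2"
proof -
  have "(\<Sum>j<k. (h (Suc j))\<^sup>2) \<le> (\<Sum>j<k. C * (h k)\<^sup>2 * real k powr \<beta> * real (Suc j) powr - \<beta>)"
  proof (intro sum_mono)
    fix j assume "j \<in> {..<k}"
    then have "(h (Suc j))\<^sup>2 \<le> C * (real k / real (Suc j)) powr \<beta> * (h k)\<^sup>2"
      by (intro reg) auto
    also have "\<dots> = C * (h k)\<^sup>2 * real k powr \<beta> * real (Suc j) powr - \<beta>"
      by (simp add: powr_divide powr_minus_divide del: of_nat_Suc)
    finally show "(h (Suc j))\<^sup>2 \<le> \<dots>" .
  qed
  also have "\<dots> = C * (h k)\<^sup>2 * real k powr \<beta> * (\<Sum>j<k. real (Suc j) powr - \<beta>)"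
    by (simp add: sum_distrib_left)
  also have "\<dots> \<le> C * (h k)\<^sup>2 * real k powr \<beta> * (real k powr (1 - \<beta>) / (1 - \<beta>))"
    using C by (intro mult_left_mono sum_powr_neg_le[OF \<beta>]) auto
  also have "\<dots> = C / (1 - \<beta>) * (real k powr \<beta> * real k powr (1 - \<beta>)) * (h k)\<^sup>2" by simp
  also have "real k powr \<beta> * real k powr (1 - \<beta>) = real k"
    by (cases "k = 0") (auto simp: powr_add[symmetric])
  finally show ?thesis .
qed

section \<open>Integrating the error bound and choosing the constants\<close>

lemma risk_le:
  fixes h :: "nat \<Rightarrow> real" and d s m n :: nat
  assumes M: "noise_ok M" and B: "valid_blocks d m B"
    and est: "\<And>Y. est Y \<in> slope_argmin d (\<lambda>j. 4 * K * h j) (mom_sigma m B Y) Y"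
    and s: "1 \<le> s" "4 * s < m" and md: "m \<le> d" "d < n * Suc m" "n \<le> d div m"
    and r: "r > 0" "512 * r\<^sup>2 \<le> real n" and K: "K > 0" and \<sigma>: "\<sigma> > 0" and th: "\<theta> \<in> Theta d s"
    and h: "\<And>i j. 1 \<le> i \<Longrightarrow> i \<le> j \<Longrightarrow> j \<le> d \<Longrightarrow> h j \<le> h i" "h d = 1"
    and \<beta>: "0 \<le> \<beta>" "\<beta> < 1" and C: "0 \<le> C"
    and reg: "\<And>j k. 1 \<le> j \<Longrightarrow> j \<le> k \<Longrightarrow> k \<le> d \<Longrightarrow> (h j)\<^sup>2 \<le> C * (real k / real j) powr \<beta> * (h k)\<^sup>2"
    and \<epsilon>: "0 < \<epsilon>" "exp 1 * \<epsilon> \<le> 1 / 2"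
    and exK: "\<And>j. 1 \<le> j \<Longrightarrow> j \<le> d \<Longrightarrow>
        (\<integral>\<^sup>+x. ennreal (excess (K * h j) x) \<partial>M) \<le> ennreal (\<epsilon> * real j / real d)"
    and exr: "(\<integral>\<^sup>+x. ennreal (excess r x) \<partial>M) \<le> ennreal (1 / (4 * r\<^sup>2))"
  shows "risk d M \<sigma> \<theta> est
    \<le> ennreal (12 * K\<^sup>2 * (C / (1 - \<beta>) * (17 + real n) + C) * \<sigma>\<^sup>2 * real s * (h s)\<^sup>2)"
proof -
  have M': "prob_space M" "sets M = sets borel" using M by (auto simp: noise_ok_def)
  interpret prob_space M by (rule M')
  let ?N = "PiM {..<d} (\<lambda>_. M)"
  interpret N: prob_space ?N by (rule prob_space_PiM) (rule M')
  have sd: "s \<le> d" and m0: "0 < m" and d0: "0 < d" using s md by auto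
  have h1: "1 \<le> h j" if "1 \<le> j" "j \<le> d" for j using h(1)[of j d] h(2) that by simp
  define C' where "C' = C / (1 - \<beta>)"
  define H where "H = (\<lambda>k. \<Sum>j<k. (h (Suc j))\<^sup>2)"
  define Q where "Q = real s * (h s)\<^sup>2"
  have C'0: "0 \<le> C'" using C \<beta> by (simp add: C'_def)
  have H0: "0 \<le> H k" for k by (simp add: H_def sum_nonneg)
  have Hs: "H s \<le> C' * Q"
    using sum_squares_weights_le[OF \<beta> C reg[OF _ _ sd]] by (simp add: H_def C'_def Q_def mult.assoc)
  have Hd: "H d \<le> C' * real d"
    using sum_squares_weights_le[OF \<beta> C reg[OF _ _ order_refl]] h(2) by (simp add: H_def C'_def)
  have Q1: "1 \<le> Q"
    using mult_mono[of 1 "real s" 1 "(h s)\<^sup>2"] h1[OF s(1) sd] s(1) by (simp add: Q_def)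
  \<comment> \<open>The expected noise excess is of order \<open>(h 1)\<^sup>2\<close> whatever s
    is. Regularity from rank 1 to rank s costs only \<open>s powr \<beta>\<close>, at most s, so
    this term also fits the rate.\<close>
  have hQ: "(h 1)\<^sup>2 \<le> C * Q"
  proof -
    have "real s powr \<beta> \<le> real s powr 1" using s \<beta> by (intro powr_mono) auto
    then have "C * real s powr \<beta> * (h s)\<^sup>2 \<le> C * real s * (h s)\<^sup>2"
      using C s by (intro mult_right_mono mult_left_mono) auto
    then show ?thesis using reg[of 1 s] s sd by (simp add: Q_def)
  qed
  \<comment> \<open>The trivial error on the low-scale event is of order d and its probability at
    most \<open>(1 / 2) ^ m\<close>; since \<open>d < n * Suc m\<close> and
    \<open>Suc m \<le> 2 ^ m\<close>, the product is bounded by \<open>n\<close>.\<close>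
  have dm: "real d * (1 / 2) ^ m \<le> real n"
  proof -
    have "Suc m \<le> 2 ^ m" by (induction m) auto
    then have "real (Suc m) \<le> 2 ^ m" by (metis of_nat_le_iff of_nat_numeral of_nat_power)
    then have "real n * real (Suc m) \<le> real n * 2 ^ m" by (intro mult_left_mono) auto
    moreover have "real d \<le> real n * real (Suc m)"
      using md(2) by (metis less_imp_le of_nat_le_iff of_nat_mult)
    ultimately have "real d \<le> real n * 2 ^ m" by linarith
    then show ?thesis by (simp add: power_divide divide_simps)
  qed
  define G where "G = clean_blocks m B \<theta>"
  have G: "G \<subseteq> {..<m}" by (auto simp: G_def clean_blocks_def)
  define V where "V = low_scale_weight m B G r"
  define W where "W = noise_excess d (\<lambda>j. K * h j) \<epsilon>"
  define Z where "Z = (\<lambda>\<xi>. \<Sum>i<m. (\<Sum>j\<in>B i. (\<xi> j)\<^sup>2) / real (card (B i)))"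
  have e1: "\<epsilon> \<le> 1"
  proof -
    have "1 * \<epsilon> \<le> exp 1 * \<epsilon>" using \<epsilon>(1) by (intro mult_right_mono) auto
    then show ?thesis using \<epsilon>(2) by simp
  qed
  have V0: "0 \<le> V \<xi>" for \<xi> unfolding V_def by (rule low_scale_weight_nonneg)
  have W0: "0 \<le> W \<xi>" for \<xi> unfolding W_def by (rule noise_excess_nonneg[OF \<epsilon>(1)])
  have Z0: "0 \<le> Z \<xi>" for \<xi> unfolding Z_def by (intro sum_nonneg divide_nonneg_nonneg) auto
  define c1 where "c1 = 12 * \<sigma>\<^sup>2 * K\<^sup>2 * H s"
  define c2 where "c2 = 12 * \<sigma>\<^sup>2 * K\<^sup>2 * H d"
  define c3 where "c3 = 12 * \<sigma>\<^sup>2"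
  define c4 where "c4 = 192 * \<sigma>\<^sup>2 * K\<^sup>2 * H s / real m"
  have c: "0 \<le> c1" "0 \<le> c2" "0 \<le> c3" "0 \<le> c4"
    using H0 by (auto simp: c1_def c2_def c3_def c4_def)
  have pt: "(\<Sum>i<d. (est (\<lambda>j. \<theta> j + \<sigma> * \<xi> j) i - \<theta> i)\<^sup>2) \<le> c1 + c2 * V \<xi> + c3 * W \<xi> + c4 * Z \<xi>" for \<xi>
  proof -
    define st where "st = mom_sigma m B (\<lambda>j. \<theta> j + \<sigma> * \<xi> j)"
    have st0: "0 \<le> st"
      unfolding st_def mom_sigma_def using med_nonneg[OF B th s(2) md(1) \<sigma>]
      by (intro real_sqrt_ge_zero)
    have "(if st < \<sigma> / 2 then H d else 0) \<le> H d * V \<xi>"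
    proof (cases "st < \<sigma> / 2")
      case True
      obtain I where I: "I \<subseteq> G" "m \<le> 4 * card I"
        "\<And>i. i \<in> I \<Longrightarrow> (\<Sum>j\<in>B i. (\<xi> j)\<^sup>2) \<le> real (card (B i)) / 2"
        using mom_sigma_small[OF B th s(2) md(1) \<sigma> True[unfolded st_def]] unfolding G_def by blast
      have "1 \<le> V \<xi>" unfolding V_def by (rule low_scale_weight_ge_1[OF B G r(1) I])
      then have "H d * 1 \<le> H d * V \<xi>" using H0 by (intro mult_left_mono) auto
      then show ?thesis using True by simp
    qed (use H0 V0 in auto)
    then have a: "4 * \<sigma>\<^sup>2 * K\<^sup>2 * (H s + (if st < \<sigma> / 2 then H d else 0))
      \<le> 4 * \<sigma>\<^sup>2 * K\<^sup>2 * (H s + H d * V \<xi>)" by (intro mult_left_mono) auto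
    have "st\<^sup>2 \<le> \<sigma>\<^sup>2 * (4 / real m * Z \<xi>)"
      unfolding st_def Z_def by (rule mom_sigma_upper[OF B th s(2) md(1) \<sigma>])
    then have b: "16 * K\<^sup>2 * st\<^sup>2 * H s \<le> 16 * K\<^sup>2 * (\<sigma>\<^sup>2 * (4 / real m * Z \<xi>)) * H s"
      using H0 by (intro mult_right_mono mult_left_mono) auto
    have "(\<Sum>i<d. (est (\<lambda>j. \<theta> j + \<sigma> * \<xi> j) i - \<theta> i)\<^sup>2)
      \<le> 3 * (4 * \<sigma>\<^sup>2 * K\<^sup>2 * (H s + (if st < \<sigma> / 2 then H d else 0))
        + 4 * \<sigma>\<^sup>2 * W \<xi> + 16 * K\<^sup>2 * st\<^sup>2 * H s)"
      unfolding H_def W_def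
    proof (rule slope_error_le[OF _ th sd K st0 \<sigma> _ _ \<epsilon>(1) e1])
      show "est (\<lambda>j. \<theta> j + \<sigma> * \<xi> j) \<in> slope_argmin d (\<lambda>j. 4 * K * h j) st (\<lambda>j. \<theta> j + \<sigma> * \<xi> j)"
        unfolding st_def by (rule est)
      show "h (Suc j) \<le> h (Suc i)" if "i \<le> j" "j < d" for i j
        using that by (intro h(1)) auto
      show "0 < h (Suc i)" if "i < d" for i
        using h1[of "Suc i"] that by simp
    qed
    also have "\<dots> \<le> 3 * (4 * \<sigma>\<^sup>2 * K\<^sup>2 * (H s + H d * V \<xi>)
        + 4 * \<sigma>\<^sup>2 * W \<xi> + 16 * K\<^sup>2 * (\<sigma>\<^sup>2 * (4 / real m * Z \<xi>)) * H s)"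
      by (intro mult_left_mono add_mono a b order_refl) simp
    also have "\<dots> = c1 + c2 * V \<xi> + c3 * W \<xi> + c4 * Z \<xi>"
      by (simp add: c1_def c2_def c3_def c4_def algebra_simps)
    finally show ?thesis .
  qed
  have meas: "V \<in> borel_measurable ?N" "W \<in> borel_measurable ?N" "Z \<in> borel_measurable ?N"
    unfolding V_def W_def Z_def
    by (rule low_scale_weight_measurable[OF M'(2) B G], rule noise_excess_measurable[OF M'(2)],
      rule nn_integral_block_means_le(2)[OF M B m0 md(1)])
  have IV: "(\<integral>\<^sup>+\<xi>. ennreal (V \<xi>) \<partial>?N) \<le> ennreal ((1 / 2) ^ m)"
    unfolding V_def using r(2) md(3)
    by (intro nn_integral_low_scale_weight_le[OF B G r(1) M exr]) (meson of_nat_le_iff order_trans)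
  have IW: "(\<integral>\<^sup>+\<xi>. ennreal (W \<xi>) \<partial>?N) \<le> ennreal ((K * h 1)\<^sup>2)"
    unfolding W_def
  proof (rule nn_integral_noise_excess_le[OF M' \<epsilon> d0])
    fix j assume j: "j < d"
    show "(\<integral>\<^sup>+x. ennreal (excess (K * h (Suc j)) x) \<partial>M) \<le> ennreal (\<epsilon> * real (Suc j) / real d)"
      using exK[of "Suc j"] j by simp
    show "0 \<le> K * h (Suc j) \<and> K * h (Suc j) \<le> K * h 1"
      using h(1)[of 1 "Suc j"] h1[of "Suc j"] j K by simp
  qed
  have IZ: "(\<integral>\<^sup>+\<xi>. ennreal (Z \<xi>) \<partial>?N) \<le> ennreal (real m)"
    unfolding Z_def by (rule nn_integral_block_means_le(1)[OF M B m0 md(1)])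
  have "risk d M \<sigma> \<theta> est \<le> (\<integral>\<^sup>+\<xi>. ennreal c1 + ennreal c2 * ennreal (V \<xi>)
      + ennreal c3 * ennreal (W \<xi>) + ennreal c4 * ennreal (Z \<xi>) \<partial>?N)"
    unfolding risk_def
    \<comment> \<open>\<open>est\<close> need not be measurable, so only monotonicity may be used on the left\<close>
  proof (intro nn_integral_mono)
    fix \<xi>
    have "ennreal c1 + ennreal c2 * ennreal (V \<xi>) + ennreal c3 * ennreal (W \<xi>) + ennreal c4 * ennreal (Z \<xi>)
      = ennreal (c1 + c2 * V \<xi> + c3 * W \<xi> + c4 * Z \<xi>)"
      using c V0[of \<xi>] W0[of \<xi>] Z0[of \<xi>] by (simp add: ennreal_mult[symmetric] ennreal_plus[symmetric] del: ennreal_plus)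
    then show "ennreal (\<Sum>i<d. (est (\<lambda>j. \<theta> j + \<sigma> * \<xi> j) i - \<theta> i)\<^sup>2)
      \<le> ennreal c1 + ennreal c2 * ennreal (V \<xi>) + ennreal c3 * ennreal (W \<xi>) + ennreal c4 * ennreal (Z \<xi>)"
      using pt[of \<xi>] by (simp add: ennreal_leI)
  qed
  also have "\<dots> = ennreal c1 + ennreal c2 * (\<integral>\<^sup>+\<xi>. ennreal (V \<xi>) \<partial>?N)
      + ennreal c3 * (\<integral>\<^sup>+\<xi>. ennreal (W \<xi>) \<partial>?N) + ennreal c4 * (\<integral>\<^sup>+\<xi>. ennreal (Z \<xi>) \<partial>?N)"
    using meas by (simp add: nn_integral_add nn_integral_cmult N.emeasure_space_1)
  also have "\<dots> \<le> ennreal c1 + ennreal c2 * ennreal ((1 / 2) ^ m)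
      + ennreal c3 * ennreal ((K * h 1)\<^sup>2) + ennreal c4 * ennreal (real m)"
    by (intro add_mono mult_left_mono IV IW IZ) auto
  also have "\<dots> = ennreal (c1 + c2 * (1 / 2) ^ m + c3 * (K * h 1)\<^sup>2 + c4 * real m)"
    using c by (simp add: ennreal_mult[symmetric] ennreal_plus[symmetric] del: ennreal_plus)
  also have "\<dots> \<le> ennreal (12 * K\<^sup>2 * (C' * (17 + real n) + C) * \<sigma>\<^sup>2 * real s * (h s)\<^sup>2)"
  proof (rule ennreal_leI)
    have "H d * (1 / 2) ^ m \<le> C' * real d * (1 / 2) ^ m" using Hd by (intro mult_right_mono) auto
    also have "\<dots> \<le> C' * real n" using mult_left_mono[OF dm C'0] by (simp add: mult.assoc)
    also have "\<dots> \<le> C' * real n * Q" using mult_left_mono[OF Q1, of "C' * real n"] C'0 by simp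
    finally have Hd': "H d * (1 / 2) ^ m \<le> C' * real n * Q" .
    \<comment> \<open>The 17 collects 1 from the deterministic term \<open>c1\<close> and 16 from
      the expected squared scale in \<open>c4\<close>.\<close>
    have "c1 + c2 * (1 / 2) ^ m + c3 * (K * h 1)\<^sup>2 + c4 * real m
      = 12 * \<sigma>\<^sup>2 * K\<^sup>2 * (17 * H s + H d * (1 / 2) ^ m + (h 1)\<^sup>2)"
      using m0 by (simp add: c1_def c2_def c3_def c4_def power_mult_distrib algebra_simps)
    also have "\<dots> \<le> 12 * \<sigma>\<^sup>2 * K\<^sup>2 * (17 * (C' * Q) + C' * real n * Q + C * Q)"
      by (intro mult_left_mono add_mono Hs Hd' hQ) auto
    also have "\<dots> = 12 * K\<^sup>2 * (C' * (17 + real n) + C) * \<sigma>\<^sup>2 * real s * (h s)\<^sup>2"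
      by (simp add: Q_def algebra_simps)
    finally show "c1 + c2 * (1 / 2) ^ m + c3 * (K * h 1)\<^sup>2 + c4 * real m
      \<le> 12 * K\<^sup>2 * (C' * (17 + real n) + C) * \<sigma>\<^sup>2 * real s * (h s)\<^sup>2" .
  qed
  finally show ?thesis by (simp add: C'_def)
qed

text \<open>The common core of both noise classes. It asks for decreasing weights normalised to 1 at
  rank d, regularity with \<open>\<beta> < 1\<close>, and a tail at level \<open>K * h d j\<close>
  of order j/d that decays in K faster than the square. All constants are fixed before d and
  s.\<close>

lemma slope_rate:
  fixes h :: "nat \<Rightarrow> nat \<Rightarrow> real" and \<M> :: "real measure set"
  assumes noise: "\<And>M. M \<in> \<M> \<Longrightarrow> noise_ok M"
    and h: "\<And>d i j. 1 \<le> i \<Longrightarrow> i \<le> j \<Longrightarrow> j \<le> d \<Longrightarrow> h d j \<le> h d i" "\<And>d. 1 \<le> d \<Longrightarrow> h d d = 1"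
    and \<beta>: "0 \<le> \<beta>" "\<beta> < 1" and C: "0 < C"
    and reg: "\<And>d j k. 1 \<le> j \<Longrightarrow> j \<le> k \<Longrightarrow> k \<le> d \<Longrightarrow>
        (h d j)\<^sup>2 \<le> C * (real k / real j) powr \<beta> * (h d k)\<^sup>2"
    and b: "b > 2" and T: "T > 0"
    and tail: "\<And>M d j K. M \<in> \<M> \<Longrightarrow> 1 \<le> j \<Longrightarrow> j \<le> d \<Longrightarrow> Kmin \<le> K \<Longrightarrow>
        measure M {x. \<bar>x\<bar> > K * h d j} \<le> T * K powr - b * (real j / real d)"
  shows "\<exists>c C \<gamma>::real. c > 0 \<and> C > 0 \<and> 0 < \<gamma> \<and> \<gamma> \<le> 1/2 \<and>
    (\<forall>d s::nat. \<forall>B est.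
       1 \<le> s \<and> real s < real (nat \<lfloor>\<gamma> * real d\<rfloor>) / 4 \<and>
       valid_blocks d (nat \<lfloor>\<gamma> * real d\<rfloor>) B \<and>
       (\<forall>Y. est Y \<in> slope_argmin d (\<lambda>j. c * h d j) (mom_sigma (nat \<lfloor>\<gamma> * real d\<rfloor>) B Y) Y) \<longrightarrow>
       (\<forall>M\<in>\<M>. \<forall>\<sigma>>0. \<forall>\<theta>\<in>Theta d s.
          risk d M \<sigma> \<theta> est \<le> ennreal (C * \<sigma>\<^sup>2 * real s * (h d s)\<^sup>2)))"
proof -
  define Q where "Q = 4 * T / (1 - 2 powr (2 - b))"
  have ex: "(\<integral>\<^sup>+x. ennreal (excess (K * h d j) x) \<partial>M) \<le> ennreal (Q * K powr - b * (real j / real d))"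
    if M: "M \<in> \<M>" and j: "1 \<le> j" "j \<le> d" and K: "Kmin \<le> K" "0 < K" for M K d j
  proof -
    have M': "prob_space M" "sets M = sets borel" using noise[OF M] by (auto simp: noise_ok_def)
    have hj: "1 \<le> h d j" using h(1)[of j d d] h(2)[of d] j by simp
    have "(\<integral>\<^sup>+x. ennreal (excess (K * h d j) x) \<partial>M)
      \<le> ennreal (4 * (T * K powr - b * (real j / real d)) / (1 - 2 powr (2 - b)))"
    proof (rule nn_integral_excess_le[OF M' _ _ b])
      fix k :: nat
      \<comment> \<open>The tail hypothesis holds for all larger multiples as well; applied to
        \<open>2 ^ k * K\<close> it supplies the geometric factor of the dyadic layers.\<close>
      have "K \<le> 2 ^ k * K" using mult_right_mono[of 1 "2 ^ k" K] K by simp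
      then have Kk: "Kmin \<le> 2 ^ k * K" using K by linarith
      have "measure M {x. \<bar>x\<bar> > (2 ^ k * K) * h d j} \<le> T * (2 ^ k * K) powr - b * (real j / real d)"
        by (rule tail[OF M j Kk])
      also have "\<dots> = T * K powr - b * (real j / real d) * (2 powr - b) ^ k"
        using K by (simp add: powr_mult powr_realpow[symmetric] powr_powr mult.commute)
      finally show "measure M {x. \<bar>x\<bar> > 2 ^ k * (K * h d j)}
        \<le> T * K powr - b * (real j / real d) * (2 powr - b) ^ k"
        by (simp add: mult.assoc)
    qed (use K hj T in auto)
    also have "4 * (T * K powr - b * (real j / real d)) / (1 - 2 powr (2 - b))
      = Q * K powr - b * (real j / real d)"
      by (simp add: Q_def mult_ac)
    finally show ?thesis .
  qed
  \<comment> \<open>The largest value with \<open>exp 1 * \<epsilon> \<le> 1 / 2\<close>.\<close>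
  define \<epsilon> :: real where "\<epsilon> = 1 / (2 * exp 1)"
  have lim: "((\<lambda>K. Q * K powr - b) \<longlongrightarrow> 0) at_top" "((\<lambda>K. Q * K powr (2 - b)) \<longlongrightarrow> 0) at_top"
    using b by (auto intro!: tendsto_mult_right_zero tendsto_neg_powr filterlim_ident)
  have "\<forall>\<^sub>F K in at_top. Kmin \<le> K \<and> 0 < K \<and> Q * K powr - b < \<epsilon>"
    by (intro eventually_conj eventually_ge_at_top eventually_gt_at_top order_tendstoD(2)[OF lim(1)])
      (simp add: \<epsilon>_def)
  from eventually_happens'[OF trivial_limit_at_top_linorder this]
  obtain K where K: "Kmin \<le> K" "0 < K" "Q * K powr - b < \<epsilon>" by blast
  \<comment> \<open>The truncation level \<open>r\<close> must keep 3/4 of the second moment, that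
    is, make \<open>r\<^sup>2\<close> times the mean excess at most 1/4; this is where
    \<open>b > 2\<close> makes the limit vanish.\<close>
  have "\<forall>\<^sub>F K in at_top. Kmin \<le> K \<and> 0 < K \<and> Q * K powr (2 - b) < 1 / 4"
    by (intro eventually_conj eventually_ge_at_top eventually_gt_at_top order_tendstoD(2)[OF lim(2)]) simp
  from eventually_happens'[OF trivial_limit_at_top_linorder this]
  obtain r where r: "Kmin \<le> r" "0 < r" "Q * r powr (2 - b) < 1 / 4" by blast
  have \<epsilon>: "0 < \<epsilon>" "exp 1 * \<epsilon> \<le> 1 / 2" by (auto simp: \<epsilon>_def)
  obtain n0 :: nat where n0: "512 * r\<^sup>2 \<le> real n0" using real_arch_simple by blast
  define n where "n = max 2 n0"
  have n: "512 * r\<^sup>2 \<le> real n" "2 \<le> n" using n0 by (auto simp: n_def)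
  have exK: "(\<integral>\<^sup>+x. ennreal (excess (K * h d j) x) \<partial>M) \<le> ennreal (\<epsilon> * real j / real d)"
    if "M \<in> \<M>" "1 \<le> j" "j \<le> d" for M d j
  proof -
    have "Q * K powr - b * (real j / real d) \<le> \<epsilon> * (real j / real d)"
      using K by (intro mult_right_mono) auto
    then show ?thesis using ex[OF that K(1,2)] by (auto intro: order_trans ennreal_leI)
  qed
  have exr: "(\<integral>\<^sup>+x. ennreal (excess r x) \<partial>M) \<le> ennreal (1 / (4 * r\<^sup>2))" if "M \<in> \<M>" for M
  proof -
    have "r powr (2 - b) = r powr - b * r\<^sup>2"
      using r powr_add[of r "- b" 2] by simp
    then have "Q * r powr - b * (4 * r\<^sup>2) \<le> 1" using r(3) by simp
    then have "Q * r powr - b \<le> 1 / (4 * r\<^sup>2)" using r by (subst pos_le_divide_eq) auto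
    \<comment> \<open>The bound for \<open>excess r\<close> is free of d; it is the case d = j = 1,
      where the weight is 1.\<close>
    then show ?thesis
      using ex[OF that _ _ r(1,2), of 1 1] h(2)[of 1] by (auto intro: order_trans ennreal_leI)
  qed
  \<comment> \<open>With \<open>\<gamma> = 1 / n\<close> the number of blocks is
    \<open>d div n\<close>, so each block has at least \<open>n \<ge> 512 * r\<^sup>2\<close>
    elements; \<open>n \<ge> 2\<close> gives \<open>\<gamma> \<le> 1 / 2\<close>.\<close>
  define \<gamma> where "\<gamma> = 1 / real n"
  have mdiv: "nat \<lfloor>\<gamma> * real d\<rfloor> = d div n" for d
    using floor_divide_of_nat_eq[where 'a = real, of d n] by (simp add: \<gamma>_def)
  define D where "D = 12 * K\<^sup>2 * (C / (1 - \<beta>) * (17 + real n) + C)"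
  show ?thesis
  proof (rule exI[of _ "4 * K"], rule exI[of _ D], rule exI[of _ \<gamma>], intro conjI allI impI ballI)
    show "0 < 4 * K" "0 < \<gamma>" "\<gamma> \<le> 1 / 2" using K n by (auto simp: \<gamma>_def divide_simps)
    show "0 < D"
      unfolding D_def using K C \<beta> by (intro mult_pos_pos add_nonneg_pos mult_nonneg_nonneg) auto
    fix d s :: nat and B est M \<theta> and \<sigma> :: real
    assume A: "1 \<le> s \<and> real s < real (nat \<lfloor>\<gamma> * real d\<rfloor>) / 4 \<and> valid_blocks d (nat \<lfloor>\<gamma> * real d\<rfloor>) B \<and>
      (\<forall>Y. est Y \<in> slope_argmin d (\<lambda>j. 4 * K * h d j) (mom_sigma (nat \<lfloor>\<gamma> * real d\<rfloor>) B Y) Y)"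
      and M: "M \<in> \<M>" and \<sigma>: "0 < \<sigma>" and th: "\<theta> \<in> Theta d s"
    define m where "m = d div n"
    note A = A[unfolded mdiv m_def[symmetric]]
    have s: "1 \<le> s" "4 * s < m" using A by auto
    have B: "valid_blocks d m B" using A by blast
    have est: "est Y \<in> slope_argmin d (\<lambda>j. 4 * K * h d j) (mom_sigma m B Y) Y" for Y
      using A by blast
    have nm: "n * m \<le> d" unfolding m_def by (metis mult.commute div_times_less_eq_dividend)
    have "m \<le> n * m" using n by simp
    then have md: "m \<le> d" using nm by linarith
    then have d1: "1 \<le> d" using s by linarith
    have d_less: "d < n * Suc m"
      unfolding m_def using n by (metis dividend_less_times_div mult_Suc_right not_numeral_le_zero neq0_conv add.commute)
    have n_le: "n \<le> d div m" using nm s by (simp add: less_eq_div_iff_mult_less_eq)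
    show "risk d M \<sigma> \<theta> est \<le> ennreal (D * \<sigma>\<^sup>2 * real s * (h d s)\<^sup>2)"
      unfolding D_def
      by (rule risk_le[where h = "h d" and m = m and n = n and \<epsilon> = \<epsilon> and r = r])
        (assumption | rule noise[OF M] B est s md d_less n_le r n K \<sigma> th h d1 \<beta> less_imp_le[OF C]
          reg \<epsilon> exK[OF M] exr[OF M])+
  qed
qed

section \<open>The two noise classes\<close>

text \<open>From \<open>ln z \<le> z - 1\<close> at \<open>z = x / p\<close>; the sharp constant
  carries a further factor \<open>exp (- p)\<close>, which is given away.\<close>

lemma powr_le_exp:
  fixes x p :: real
  assumes "x > 0" "p > 0"
  shows "x powr p \<le> p powr p * exp x"
proof -
  have "ln (x / p) \<le> x / p - 1" using assms by (intro ln_le_minus_one) auto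
  then have "p * ln (x / p) \<le> p * (x / p - 1)" using assms by (intro mult_left_mono) auto
  then have "p * ln x \<le> p * ln p + x" using assms by (simp add: ln_div algebra_simps)
  then have "exp (p * ln x) \<le> exp (p * ln p + x)" by simp
  then show ?thesis using assms by (simp add: powr_def exp_add)
qed

lemma powr_inverse_power2:
  fixes x a :: real
  shows "(x powr (1 / a))\<^sup>2 = x powr (2 / a)"
  by (simp add: power2_eq_square powr_add[symmetric])

text \<open>The tail beats every power and the logarithm varies slowly, so \<open>b = 3\<close> and
  \<open>\<beta> = 1 / 2\<close> are convenient choices among many. In \<open>Kmin\<close>, the 2
  reaches the range of the tail assumption and \<open>\<tau>\<close> ensures
  \<open>K / \<tau> \<ge> 1\<close>.\<close>

lemma slope_rate_exponential_tail:
  fixes a \<tau> :: real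
  assumes a: "a > 0" and \<tau>: "\<tau> > 0"
  shows "\<exists>c C \<gamma>::real. c > 0 \<and> C > 0 \<and> 0 < \<gamma> \<and> \<gamma> \<le> 1/2 \<and>
    (\<forall>d s::nat. \<forall>B est.
       1 \<le> s \<and> real s < real (nat \<lfloor>\<gamma> * real d\<rfloor>) / 4 \<and>
       valid_blocks d (nat \<lfloor>\<gamma> * real d\<rfloor>) B \<and>
       (\<forall>Y. est Y \<in> slope_argmin d (\<lambda>j. c * ln (exp 1 * real d / real j) powr (1 / a))
          (mom_sigma (nat \<lfloor>\<gamma> * real d\<rfloor>) B Y) Y) \<longrightarrow>
       (\<forall>M\<in>G_class a \<tau>. \<forall>\<sigma>>0. \<forall>\<theta>\<in>Theta d s.
          risk d M \<sigma> \<theta> est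
            \<le> ennreal (C * \<sigma>\<^sup>2 * real s * (ln (exp 1 * real d / real s) powr (1 / a))\<^sup>2)))"
proof (rule slope_rate[where b = 3 and \<beta> = "1 / 2" and Kmin = "max 2 \<tau>"
      and C = "(4 / a) powr (2 / a) * exp (1 / 2)" and T = "2 * (3 / a) powr (3 / a) * \<tau> powr 3"])
  have L: "ln (exp 1 * real d / real j) = 1 + ln (real d / real j)" if "1 \<le> j" "j \<le> d" for d j
    using that ln_mult[of "exp 1" "real d / real j"] by simp
  have L1: "1 \<le> ln (exp 1 * real d / real j)" if "1 \<le> j" "j \<le> d" for d j
    using that by (simp add: L)
  show "noise_ok M" if "M \<in> G_class a \<tau>" for M using that by (simp add: G_class_def)
  show "ln (exp 1 * real d / real j) powr (1 / a) \<le> ln (exp 1 * real d / real i) powr (1 / a)"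
    if "1 \<le> i" "i \<le> j" "j \<le> d" for d i j
  proof (rule powr_mono2)
    show "0 \<le> ln (exp 1 * real d / real j)" using L1[of j d] that by linarith
    show "ln (exp 1 * real d / real j) \<le> ln (exp 1 * real d / real i)"
    proof -
      have "real d / real j \<le> real d / real i" using that by (intro divide_left_mono) auto
      then have "ln (real d / real j) \<le> ln (real d / real i)" using that by (subst ln_le_cancel_iff) auto
      then show ?thesis using that by (simp add: L)
    qed
  qed (use a in simp)
  show "ln (exp 1 * real d / real d) powr (1 / a) = 1" if "1 \<le> d" for d using that by simp
  show "(ln (exp 1 * real d / real j) powr (1 / a))\<^sup>2
    \<le> (4 / a) powr (2 / a) * exp (1 / 2) * (real k / real j) powr (1 / 2)
      * (ln (exp 1 * real d / real k) powr (1 / a))\<^sup>2"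
    if jk: "1 \<le> j" "j \<le> k" "k \<le> d" for d j k
  proof -
    define x where "x = ln (exp 1 * real d / real k)"
    define y where "y = 1 + ln (real k / real j)"
    have x1: "1 \<le> x" using L1[of k d] jk by (simp add: x_def)
    have y1: "1 \<le> y" using jk by (simp add: y_def)
    have "ln (exp 1 * real d / real j) = x + ln (real k / real j)"
      using jk by (simp add: x_def L ln_div)
    also have "\<dots> \<le> x * y"
      using mult_right_mono[OF x1, of "ln (real k / real j)"] jk by (simp add: y_def distrib_left)
    finally have le: "ln (exp 1 * real d / real j) \<le> x * y" .
    have "0 \<le> ln (exp 1 * real d / real j)" using L1[of j d] jk by linarith
    then have "ln (exp 1 * real d / real j) powr (2 / a) \<le> (x * y) powr (2 / a)"
      using a by (intro powr_mono2[OF _ _ le]) simp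
    also have "\<dots> = x powr (2 / a) * y powr (2 / a)" using x1 y1 by (simp add: powr_mult)
    finally have "ln (exp 1 * real d / real j) powr (2 / a) \<le> x powr (2 / a) * y powr (2 / a)" .
    \<comment> \<open>The exponential bound is applied at \<open>y / 2\<close> and not at
      \<open>y\<close>, so that \<open>exp (y / 2)\<close> produces the power 1/2 of
      \<open>k / j\<close>, as \<open>\<beta> = 1 / 2\<close> requires.\<close>
    moreover have "y powr (2 / a) \<le> (4 / a) powr (2 / a) * exp (1 / 2) * (real k / real j) powr (1 / 2)"
    proof -
      have "y powr (2 / a) = 2 powr (2 / a) * (y / 2) powr (2 / a)"
        using y1 by (simp add: powr_mult[symmetric])
      also have "\<dots> \<le> 2 powr (2 / a) * ((2 / a) powr (2 / a) * exp (y / 2))"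
        using y1 a by (intro mult_left_mono powr_le_exp) auto
      also have "2 powr (2 / a) * ((2 / a) powr (2 / a) * exp (y / 2)) = (4 / a) powr (2 / a) * exp (y / 2)"
        using a by (simp add: powr_mult[symmetric] mult.assoc[symmetric])
      also have "exp (y / 2) = exp (1 / 2) * (real k / real j) powr (1 / 2)"
        using jk by (simp add: y_def powr_def add_divide_distrib exp_add)
      finally show ?thesis by (simp add: mult.assoc)
    qed
    ultimately have "ln (exp 1 * real d / real j) powr (2 / a)
      \<le> x powr (2 / a) * ((4 / a) powr (2 / a) * exp (1 / 2) * (real k / real j) powr (1 / 2))"
      by (meson mult_left_mono order_trans powr_ge_zero)
    then show ?thesis
      unfolding powr_inverse_power2 x_def[symmetric] by (simp only: mult.commute)
  qed
  show "measure M {x. \<bar>x\<bar> > K * ln (exp 1 * real d / real j) powr (1 / a)}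
    \<le> 2 * (3 / a) powr (3 / a) * \<tau> powr 3 * K powr - 3 * (real j / real d)"
    if M: "M \<in> G_class a \<tau>" and j: "1 \<le> j" "j \<le> d" and K: "max 2 \<tau> \<le> K" for M d j K
  proof -
    define l where "l = ln (exp 1 * real d / real j)"
    define y where "y = (K / \<tau>) powr a"
    have l1: "1 \<le> l" using L1[OF j] by (simp add: l_def)
    have y1: "1 \<le> y" using K \<tau> a by (simp add: y_def ge_one_powr_ge_zero)
    have "2 * 1 \<le> K * l powr (1 / a)"
      using K l1 a by (intro mult_mono) (auto simp: ge_one_powr_ge_zero)
    then have "measure M {x. \<bar>x\<bar> > K * l powr (1 / a)} \<le> 2 * exp (- ((K * l powr (1 / a) / \<tau>) powr a))"
      using M by (simp add: G_class_def)
    also have "(K * l powr (1 / a) / \<tau>) powr a = y * l"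
    proof -
      have "K * l powr (1 / a) / \<tau> = K / \<tau> * l powr (1 / a)" by simp
      moreover have "(K / \<tau> * l powr (1 / a)) powr a = (K / \<tau>) powr a * (l powr (1 / a)) powr a"
        by (rule powr_mult)
      ultimately show ?thesis using a l1 by (simp add: y_def powr_powr)
    qed
    finally have tail: "measure M {x. \<bar>x\<bar> > K * l powr (1 / a)} \<le> 2 * exp (- (y * l))" .
    \<comment> \<open>For \<open>y\<close> and \<open>l\<close> at least 1 one has
      \<open>y * l \<ge> y + l - 1\<close>. This separates the decay in K, carried by
      \<open>y\<close>, from the factor j/d, carried by \<open>l\<close>.\<close>
    have e1: "exp (- (y * l)) \<le> exp (- y) * exp (1 - l)"
    proof -
      have "0 \<le> (y - 1) * (l - 1)" using y1 l1 by (intro mult_nonneg_nonneg) auto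
      then show ?thesis by (simp add: exp_add[symmetric] algebra_simps)
    qed
    have e2: "exp (1 - l) = real j / real d"
      using j by (simp add: l_def L exp_diff exp_add exp_minus)
    have e3: "exp (- y) \<le> (3 / a) powr (3 / a) * \<tau> powr 3 * K powr - 3"
    proof -
      have "y powr (3 / a) \<le> (3 / a) powr (3 / a) * exp y" using y1 a by (intro powr_le_exp) auto
      moreover have "y powr (3 / a) = (K / \<tau>) powr 3" using a by (simp add: y_def powr_powr)
      ultimately have "(K / \<tau>) powr 3 * exp (- y) \<le> (3 / a) powr (3 / a)"
        by (simp add: exp_minus divide_simps)
      then have "(K / \<tau>) powr 3 * exp (- y) * (\<tau> powr 3 * K powr - 3)
        \<le> (3 / a) powr (3 / a) * (\<tau> powr 3 * K powr - 3)"
        by (intro mult_right_mono) auto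
      moreover have "(K / \<tau>) powr 3 * exp (- y) * (\<tau> powr 3 * K powr - 3) = exp (- y)"
        using K \<tau> by (simp add: powr_divide powr_minus)
      ultimately show ?thesis by linarith
    qed
    have "exp (- (y * l)) \<le> (3 / a) powr (3 / a) * \<tau> powr 3 * K powr - 3 * (real j / real d)"
      by (rule order_trans[OF e1[unfolded e2]]) (intro mult_right_mono e3, simp)
    then show ?thesis using tail unfolding l_def by linarith
  qed
qed (use a \<tau> in auto)

text \<open>The weights make the tail at level \<open>K * h d j\<close> proportional to j/d exactly,
  and regularity is an identity with \<open>\<beta> = 2 / a\<close>. The assumption
  \<open>a > 2\<close> serves twice: for \<open>b = a > 2\<close> and for
  \<open>\<beta> < 1\<close>.\<close>

lemma slope_rate_polynomial_tail:
  fixes a \<tau> :: real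
  assumes a: "a > 2" and \<tau>: "\<tau> > 0"
  shows "\<exists>c C \<gamma>::real. c > 0 \<and> C > 0 \<and> 0 < \<gamma> \<and> \<gamma> \<le> 1/2 \<and>
    (\<forall>d s::nat. \<forall>B est.
       1 \<le> s \<and> real s < real (nat \<lfloor>\<gamma> * real d\<rfloor>) / 4 \<and>
       valid_blocks d (nat \<lfloor>\<gamma> * real d\<rfloor>) B \<and>
       (\<forall>Y. est Y \<in> slope_argmin d (\<lambda>j. c * (real d / real j) powr (1 / a))
          (mom_sigma (nat \<lfloor>\<gamma> * real d\<rfloor>) B Y) Y) \<longrightarrow>
       (\<forall>M\<in>P_class a \<tau>. \<forall>\<sigma>>0. \<forall>\<theta>\<in>Theta d s.
          risk d M \<sigma> \<theta> est
            \<le> ennreal (C * \<sigma>\<^sup>2 * real s * ((real d / real s) powr (1 / a))\<^sup>2)))"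
proof (rule slope_rate[where b = a and \<beta> = "2 / a" and Kmin = 2 and C = 1 and T = "\<tau> powr a"])
  show "noise_ok M" if "M \<in> P_class a \<tau>" for M using that by (simp add: P_class_def)
  show "(real d / real j) powr (1 / a) \<le> (real d / real i) powr (1 / a)"
    if "1 \<le> i" "i \<le> j" "j \<le> d" for d i j
    using that a by (intro powr_mono2 divide_left_mono) auto
  show "((real d / real j) powr (1 / a))\<^sup>2
    \<le> 1 * (real k / real j) powr (2 / a) * ((real d / real k) powr (1 / a))\<^sup>2"
    if "1 \<le> j" "j \<le> k" "k \<le> d" for d j k
    unfolding powr_inverse_power2 using that by (simp add: powr_mult[symmetric])
  show "measure M {x. \<bar>x\<bar> > K * (real d / real j) powr (1 / a)}
    \<le> \<tau> powr a * K powr - a * (real j / real d)"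
    if M: "M \<in> P_class a \<tau>" and j: "1 \<le> j" "j \<le> d" and K: "2 \<le> K" for M d j K
  proof -
    have "2 * 1 \<le> K * (real d / real j) powr (1 / a)"
      using K j a by (intro mult_mono) (auto simp: ge_one_powr_ge_zero)
    then have "measure M {x. \<bar>x\<bar> > K * (real d / real j) powr (1 / a)}
      \<le> (\<tau> / (K * (real d / real j) powr (1 / a))) powr a"
      using M by (simp add: P_class_def)
    also have "\<dots> = \<tau> powr a * K powr - a * (real j / real d)"
      using K j a \<tau> by (simp add: powr_divide powr_mult powr_powr powr_minus divide_simps)
    finally show ?thesis .
  qed
qed (use a \<tau> in auto)

theorem theorem1:
  shows "(\<forall>a \<tau>::real. a > 0 \<and> \<tau> > 0 \<longrightarrow>
           (\<exists>c C \<gamma>::real. c > 0 \<and> C > 0 \<and> 0 < \<gamma> \<and> \<gamma> \<le> 1/2 \<and>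
             (\<forall>d s::nat. \<forall>B est.
                1 \<le> s \<and> real s < real (nat \<lfloor>\<gamma> * real d\<rfloor>) / 4 \<and>
                valid_blocks d (nat \<lfloor>\<gamma> * real d\<rfloor>) B \<and>
                (\<forall>Y. est Y \<in> slope_argmin d (\<lambda>j. c * ln (exp 1 * real d / real j) powr (1 / a))
                                (mom_sigma (nat \<lfloor>\<gamma> * real d\<rfloor>) B Y) Y) \<longrightarrow>
                (\<forall>M\<in>G_class a \<tau>. \<forall>\<sigma>>0. \<forall>\<theta>\<in>Theta d s.
                   risk d M \<sigma> \<theta> est
                     \<le> ennreal (C * \<sigma>\<^sup>2 * real s * ln (exp 1 * real d / real s) powr (2 / a))))))
       \<and>
       (\<forall>a \<tau>::real. a > 2 \<and> \<tau> > 0 \<longrightarrow>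
           (\<exists>c C \<gamma>::real. c > 0 \<and> C > 0 \<and> 0 < \<gamma> \<and> \<gamma> \<le> 1/2 \<and>
             (\<forall>d s::nat. \<forall>B est.
                1 \<le> s \<and> real s < real (nat \<lfloor>\<gamma> * real d\<rfloor>) / 4 \<and>
                valid_blocks d (nat \<lfloor>\<gamma> * real d\<rfloor>) B \<and>
                (\<forall>Y. est Y \<in> slope_argmin d (\<lambda>j. c * (real d / real j) powr (1 / a))
                                (mom_sigma (nat \<lfloor>\<gamma> * real d\<rfloor>) B Y) Y) \<longrightarrow>
                (\<forall>M\<in>P_class a \<tau>. \<forall>\<sigma>>0. \<forall>\<theta>\<in>Theta d s.
                   risk d M \<sigma> \<theta> est
                     \<le> ennreal (C * \<sigma>\<^sup>2 * real s * (real d / real s) powr (2 / a))))))"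
  using slope_rate_exponential_tail slope_rate_polynomial_tail
  unfolding powr_inverse_power2 by simp

end
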